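(* Let $\mathbb{F}$ be a field and $d \geq 0$ an integer. Consider the following sets: (i) the diagonal equivalence classes of almost orthogonal (AO) solid invertible matrices in $\mathrm{Mat}_{d+1}(\mathbb{F})$; (ii) the isomorphism classes of symmetric idempotent systems over $\mathbb{F}$ with diameter $d$. For a class $\rho$ in (i), let $\Phi_\rho$ denote the isomorphism class of idempotent systems that contains $\Phi_R = (\{\Delta_{i,i}\}_{i=0}^d; \{R\Delta_{i,i}R^{-1}\}_{i=0}^d)$ for all $R \in \rho$. Then the map $\rho \mapsto \Phi_\rho$ is a bijection from (i) to (ii).
   Context: All algebras are associative, unital, over $\mathbb{F}$. $\mathrm{Mat}_{d+1}(\mathbb{F})$ is the algebra of $(d+1)\times(d+1)$ matrices over $\mathbb{F}$, with rows and columns indexed by $0,1,\ldots,d$. $\Delta_{i,j}$ is the matrix with $(i,j)$-entry $1$ and all other entries $0$. Let $\mathcal{A}$ be an algebra isomorphic to $\mathrm{Mat}_{d+1}(\mathbb{F})$ (rank of an element means the rank of its image under such an isomorphism). A system of mutually orthogonal rank $1$ idempotents in $\mathcal{A}$ is a sequence $\{E_i\}_{i=0}^d$ with $E_iE_j = \delta_{i,j}E_i$ and $\mathrm{rank}(E_i)=1$ for $0\le i,j\le d$. An idempotent system in $\mathcal{A}$ is a sequence $\Phi = (\{E_i\}_{i=0}^d; \{E^*_i\}_{i=0}^d)$ such that (i) $\{E_i\}_{i=0}^d$ and (ii) $\{E^*_i\}_{i=0}^d$ are systems of mutually orthogonal rank $1$ idempotents in $\mathcal{A}$; (iii) $E_0E^*_iE_0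 \neq 0$ for $0\le i\le d$; (iv) $E^*_0E_iE^*_0\neq 0$ for $0\le i\le d$. Such $\Phi$ is said to be over $\mathbb{F}$ with diameter $d$. $\Phi$ is symmetric if there is an antiautomorphism of $\mathcal{A}$ (an $\mathbb{F}$-linear bijection $\tau$ with $(YZ)^\tau = Z^\tau Y^\tau$) that fixes each $E_i$ and $E^*_i$, $0\le i\le d$. An isomorphism of idempotent systems from $\Phi$ (in $\mathcal{A}$) to $\Phi'$ (in $\mathcal{A}'$) is an algebra isomorphism $\mathcal{A}\to\mathcal{A}'$ sending $E_i\mapsto E'_i$ and $E^*_i\mapsto E^{*\prime}_i$ for $0\le i\le d$. An invertible $R\in\mathrm{Mat}_{d+1}(\mathbb{F})$ is solid if for both $R$ and $R^{-1}$ all entries in column $0$ and in row $0$ are nonzero. Matrices $S,T \in \mathrm{Mat}_{d+1}(\mathbb{F})$ are diagonally equivalent if $T=HSK$ for some invertible diagonal matrices $H,K$. A matrix $R$ is almost orthogonal (AO) if $R$ is invertible and its transpose $R^{\sf t}$ is diagonally equivalent to $R^{-1}$. Both properties, solid invertible and AO, are invariant under diagonal equivalence. For solid invertible $R$, $\Phi_R$ is an idempotent system in $\mathrm{Mat}_{d+1}(\mathbb{F})$, and $\Phi_R,\Phi_S$ are isomorphic when $R,S$ are diagonally equivalent, so $\Phi_\rho$ is well defined. *)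

theory Defs
  imports
    "HOL-Algebra.QuotRing"
    "HOL-Algebra.Module"
    "Jordan_Normal_Form.DL_Rank"
    "Jordan_Normal_Form.Gauss_Jordan_Elimination"
begin

section \<open>Associative unital algebras over a field\<close>

text \<open>The scalars are a type of class field, wrapped as \<^term>\<open>class_ring\<close>. The locale
  \<^locale>\<open>algebra\<close> of the library requires a commutative multiplication, so it does not apply
  here.\<close>

definition assoc_algebra :: "('f::field, 'a) module \<Rightarrow> bool" where
  "assoc_algebra A \<longleftrightarrow>
     ring A \<and> module (class_ring :: 'f ring) A \<and>
     (\<forall>c. \<forall>x\<in>carrier A. \<forall>y\<in>carrier A.
        (c \<odot>\<^bsub>A\<^esub> x) \<otimes>\<^bsub>A\<^esub> y = c \<odot>\<^bsub>A\<^esub> (x \<otimes>\<^bsub>A\<^esub> y) \<and>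
        x \<otimes>\<^bsub>A\<^esub> (c \<odot>\<^bsub>A\<^esub> y) = c \<odot>\<^bsub>A\<^esub> (x \<otimes>\<^bsub>A\<^esub> y))"

definition algebra_iso :: "('f::field, 'a) module \<Rightarrow> ('f, 'b) module \<Rightarrow> ('a \<Rightarrow> 'b) set" where
  "algebra_iso A B =
     {\<phi> \<in> ring_iso A B. \<forall>c. \<forall>x\<in>carrier A. \<phi> (c \<odot>\<^bsub>A\<^esub> x) = c \<odot>\<^bsub>B\<^esub> \<phi> x}"

definition antiautomorphism :: "('f::field, 'a) module \<Rightarrow> ('a \<Rightarrow> 'a) \<Rightarrow> bool" where
  "antiautomorphism A \<tau> \<longleftrightarrow>
     bij_betw \<tau> (carrier A) (carrier A) \<and>
     (\<forall>x\<in>carrier A. \<forall>y\<in>carrier A. \<tau> (x \<oplus>\<^bsub>A\<^esub> y) = \<tau> x \<oplus>\<^bsub>A\<^esub> \<tau> y) \<and>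
     (\<forall>c. \<forall>x\<in>carrier A. \<tau> (c \<odot>\<^bsub>A\<^esub> x) = c \<odot>\<^bsub>A\<^esub> \<tau> x) \<and>
     (\<forall>x\<in>carrier A. \<forall>y\<in>carrier A. \<tau> (x \<otimes>\<^bsub>A\<^esub> y) = \<tau> y \<otimes>\<^bsub>A\<^esub> \<tau> x)"

abbreviation mat_algebra :: "nat \<Rightarrow> ('f::field, 'f mat) module" where
  "mat_algebra n \<equiv> module_mat TYPE('f) n n"

definition is_mat_algebra :: "nat \<Rightarrow> ('f::field, 'a) module \<Rightarrow> bool" where
  "is_mat_algebra n A \<longleftrightarrow> assoc_algebra A \<and> algebra_iso A (mat_algebra n) \<noteq> {}"

text \<open>The rank does not depend on the isomorphism chosen, since every automorphism of a full
  matrix algebra preserves ranks.\<close>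

definition alg_rank :: "nat \<Rightarrow> ('f::field, 'a) module \<Rightarrow> 'a \<Rightarrow> nat" where
  "alg_rank n A x = vec_space.rank n ((SOME \<phi>. \<phi> \<in> algebra_iso A (mat_algebra n)) x)"

section \<open>Idempotent systems\<close>

text \<open>A triple consists of the ambient algebra and the two sequences. Only the entries with
  index at most \<open>d\<close> are meaningful; the others are ignored by every notion below, in particular
  by isomorphism.\<close>

type_synonym ('f, 'a) idem_sys = "('f, 'a) module \<times> (nat \<Rightarrow> 'a) \<times> (nat \<Rightarrow> 'a)"

definition orth_rank1_idempotents ::
    "nat \<Rightarrow> ('f::field, 'a) module \<Rightarrow> (nat \<Rightarrow> 'a) \<Rightarrow> bool" where
  "orth_rank1_idempotents d A E \<longleftrightarrow>
     (\<forall>i\<le>d. E i \<in> carrier A \<and> alg_rank (d + 1) A (E i) = 1) \<and>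
     (\<forall>i\<le>d. \<forall>j\<le>d. E i \<otimes>\<^bsub>A\<^esub> E j = (if i = j then E i else \<zero>\<^bsub>A\<^esub>))"

definition idempotent_system :: "nat \<Rightarrow> ('f::field, 'a) idem_sys \<Rightarrow> bool" where
  "idempotent_system d = (\<lambda>(A, E, Es).
     is_mat_algebra (d + 1) A \<and>
     orth_rank1_idempotents d A E \<and>
     orth_rank1_idempotents d A Es \<and>
     (\<forall>i\<le>d. E 0 \<otimes>\<^bsub>A\<^esub> Es i \<otimes>\<^bsub>A\<^esub> E 0 \<noteq> \<zero>\<^bsub>A\<^esub>) \<and>
     (\<forall>i\<le>d. Es 0 \<otimes>\<^bsub>A\<^esub> E i \<otimes>\<^bsub>A\<^esub> Es 0 \<noteq> \<zero>\<^bsub>A\<^esub>))"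

definition symmetric_idempotent_system :: "nat \<Rightarrow> ('f::field, 'a) idem_sys \<Rightarrow> bool" where
  "symmetric_idempotent_system d = (\<lambda>(A, E, Es).
     idempotent_system d (A, E, Es) \<and>
     (\<exists>\<tau>. antiautomorphism A \<tau> \<and> (\<forall>i\<le>d. \<tau> (E i) = E i \<and> \<tau> (Es i) = Es i)))"

definition idem_sys_isomorphic ::
    "nat \<Rightarrow> ('f::field, 'a) idem_sys \<Rightarrow> ('f, 'b) idem_sys \<Rightarrow> bool" where
  "idem_sys_isomorphic d = (\<lambda>(A, E, Es) (B, F, Fs).
     \<exists>\<phi>\<in>algebra_iso A B. \<forall>i\<le>d. \<phi> (E i) = F i \<and> \<phi> (Es i) = Fs i)"

text \<open>Isomorphism classes are sets, so they are formed inside a fixed type of carrier elements.\<close>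

definition idem_sys_iso_rel :: "nat \<Rightarrow> ('f::field, 'a) idem_sys rel" where
  "idem_sys_iso_rel d =
     {(\<Phi>, \<Psi>). idempotent_system d \<Phi> \<and> idempotent_system d \<Psi> \<and> idem_sys_isomorphic d \<Phi> \<Psi>}"

definition idem_sys_classes :: "nat \<Rightarrow> ('f::field, 'a) idem_sys set set" where
  "idem_sys_classes d = {\<Phi>. idempotent_system d \<Phi>} // idem_sys_iso_rel d"

definition symmetric_idem_sys_classes :: "nat \<Rightarrow> ('f::field, 'a) idem_sys set set" where
  "symmetric_idem_sys_classes d = {\<Phi>. symmetric_idempotent_system d \<Phi>} // idem_sys_iso_rel d"

section \<open>Solid invertible and almost orthogonal matrices\<close>

text \<open>\<^term>\<open>mat_inverse\<close> yields an option; the definition is only meant for invertible \<open>R\<close>.\<close>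

definition mat_inv :: "'f::field mat \<Rightarrow> 'f mat" where
  "mat_inv R = the (mat_inverse R)"

definition solid_invertible :: "nat \<Rightarrow> 'f::field mat \<Rightarrow> bool" where
  "solid_invertible d R \<longleftrightarrow>
     R \<in> carrier_mat (d + 1) (d + 1) \<and> invertible_mat R \<and>
     (\<forall>i\<le>d. R $$ (i, 0) \<noteq> 0 \<and> R $$ (0, i) \<noteq> 0 \<and>
            mat_inv R $$ (i, 0) \<noteq> 0 \<and> mat_inv R $$ (0, i) \<noteq> 0)"

definition diag_equiv :: "nat \<Rightarrow> 'f::field mat rel" where
  "diag_equiv d =
     {(S, T). S \<in> carrier_mat (d + 1) (d + 1) \<and> T \<in> carrier_mat (d + 1) (d + 1) \<and>
        (\<exists>H\<in>carrier_mat (d + 1) (d + 1). \<exists>K\<in>carrier_mat (d + 1) (d + 1).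
           diagonal_mat H \<and> invertible_mat H \<and> diagonal_mat K \<and> invertible_mat K \<and>
           T = H * S * K)}"

definition almost_orthogonal :: "nat \<Rightarrow> 'f::field mat \<Rightarrow> bool" where
  "almost_orthogonal d R \<longleftrightarrow>
     R \<in> carrier_mat (d + 1) (d + 1) \<and> invertible_mat R \<and>
     (transpose_mat R, mat_inv R) \<in> diag_equiv d"

definition AO_solid_classes :: "nat \<Rightarrow> 'f::field mat set set" where
  "AO_solid_classes d = {R. almost_orthogonal d R \<and> solid_invertible d R} // diag_equiv d"

section \<open>From matrices to idempotent systems\<close>

definition Delta :: "nat \<Rightarrow> nat \<Rightarrow> nat \<Rightarrow> 'f::field mat" where
  "Delta d i j = mat (d + 1) (d + 1) (\<lambda>(r, s). if r = i \<and> s = j then 1 else 0)"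

definition Phi :: "nat \<Rightarrow> 'f::field mat \<Rightarrow> ('f, 'f mat) idem_sys" where
  "Phi d R = (mat_algebra (d + 1), \<lambda>i. Delta d i i, \<lambda>i. R * Delta d i i * mat_inv R)"

definition Phi_class :: "nat \<Rightarrow> 'f::field mat set \<Rightarrow> ('f, 'f mat) idem_sys set" where
  "Phi_class d \<rho> = (THE C. C \<in> idem_sys_classes d \<and> (\<forall>R\<in>\<rho>. Phi d R \<in> C))"

end

theory Submission
  imports Defs
begin

text \<open>Every automorphism of a full matrix algebra is conjugation by some \<open>P\<close>, and mutually orthogonal
  nonzero idempotents \<open>E\<^sub>0, \<dots>, E\<^sub>d\<close> are simultaneously conjugate to the diagonal matrix units. So every
  idempotent system is isomorphic to some \<open>\<Phi>\<^sub>R\<close>, where \<open>R\<close> compares the two eigenbases; solidity of \<open>R\<close> is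
  exactly the nonvanishing of the triple products. Since \<open>U \<Delta>\<^sub>i\<^sub>i U\<^sup>-\<^sup>1 = V \<Delta>\<^sub>i\<^sub>i V\<^sup>-\<^sup>1\<close> for all \<open>i\<close> means that
  \<open>V\<^sup>-\<^sup>1 U\<close> is diagonal, an isomorphism \<open>\<Phi>\<^sub>R \<rightarrow> \<Phi>\<^sub>S\<close> is conjugation by a diagonal \<open>P\<close> with \<open>S\<^sup>-\<^sup>1 P R\<close>
  diagonal, i.e. a diagonal equivalence. Likewise an antiautomorphism fixing \<open>\<Phi>\<^sub>R\<close> is \<open>Y \<mapsto> P Y\<^sup>t P\<^sup>-\<^sup>1\<close>
  with \<open>P\<close> and \<open>R\<^sup>-\<^sup>1 P (R\<^sup>t)\<^sup>-\<^sup>1\<close> diagonal, i.e. a witness that \<open>R\<close> is almost orthogonal.\<close>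

section \<open>Matrix units\<close>

lemma Delta_carrier: "Delta d i j \<in> carrier_mat (d + 1) (d + 1)"
  by (simp add: Delta_def)

lemma dim_Delta [simp]: "dim_row (Delta d i j) = Suc d" "dim_col (Delta d i j) = Suc d"
  by (simp_all add: Delta_def)

lemma Delta_carrier_Suc [simp]: "Delta d i j \<in> carrier_mat (Suc d) (Suc d)"
  by (simp add: Delta_def)

lemma index_Delta [simp]:
  "r \<le> d \<Longrightarrow> s \<le> d \<Longrightarrow> Delta d i j $$ (r, s) = (if r = i \<and> s = j then 1 else 0)"
  by (simp add: Delta_def)

lemma index_Delta_mult:
  assumes "B \<in> carrier_mat (d + 1) (d + 1)" "j \<le> d" "r \<le> d" "s \<le> d"
  shows "(Delta d i j * B) $$ (r, s) = (if r = i then B $$ (j, s) else (0 :: 'f::field))"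
proof -
  have "(Delta d i j * B) $$ (r, s) = (\<Sum>k = 0..<d + 1. Delta d i j $$ (r, k) * B $$ (k, s))"
    using assms by (simp add: times_mat_def scalar_prod_def Delta_def)
  also have "\<dots> = (\<Sum>k = 0..<d + 1. if k = j then (if r = i then B $$ (j, s) else 0) else 0)"
    using assms by (intro sum.cong) auto
  finally show ?thesis
    using assms by simp
qed

lemma index_mult_Delta:
  assumes "A \<in> carrier_mat (d + 1) (d + 1)" "i \<le> d" "r \<le> d" "s \<le> d"
  shows "(A * Delta d i j) $$ (r, s) = (if s = j then A $$ (r, i) else (0 :: 'f::field))"
proof -
  have "(A * Delta d i j) $$ (r, s) = (\<Sum>k = 0..<d + 1. A $$ (r, k) * Delta d i j $$ (k, s))"
    using assms by (simp add: times_mat_def scalar_prod_def Delta_def)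
  also have "\<dots> = (\<Sum>k = 0..<d + 1. if k = i then (if s = j then A $$ (r, i) else 0) else 0)"
    using assms by (intro sum.cong) auto
  finally show ?thesis
    using assms by simp
qed

text \<open>The product is column \<open>i\<close> of \<open>A\<close> times row \<open>j\<close> of
  \<open>B\<close>, an outer product. This shape bounds the rank of conjugated units and supplies
  the entries that occur in the solidity criterion.\<close>

lemma index_mult_Delta_mult:
  assumes "A \<in> carrier_mat (d + 1) (d + 1)" "B \<in> carrier_mat (d + 1) (d + 1)"
    and "i \<le> d" "j \<le> d" "r \<le> d" "s \<le> d"
  shows "(A * Delta d i j * B) $$ (r, s) = A $$ (r, i) * (B $$ (j, s) :: 'f::field)"
proof -
  have "(A * Delta d i j * B) $$ (r, s) = (\<Sum>k = 0..<d + 1. (A * Delta d i j) $$ (r, k) * B $$ (k, s))"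
    using assms by (simp add: times_mat_def scalar_prod_def Delta_def)
  also have "\<dots> = (\<Sum>k = 0..<d + 1. if k = j then A $$ (r, i) * B $$ (j, s) else 0)"
    using assms by (intro sum.cong) (auto simp: index_mult_Delta simp del: index_mult_mat)
  finally show ?thesis
    using assms by simp
qed

lemma Delta_mult_Delta:
  assumes "j \<le> d" "k \<le> d"
  shows "Delta d i j * Delta d k l = (if j = k then Delta d i l else (0\<^sub>m (d + 1) (d + 1) :: 'f::field mat))"
  using assms by (intro eq_matI) (auto simp: index_Delta_mult simp del: index_mult_mat(1))

text \<open>Left multiplication by \<open>Delta d i i\<close> keeps only row \<open>i\<close>, right
  multiplication by \<open>Delta d j j\<close> only column \<open>j\<close>. A single entry thus
  becomes an algebraic expression that homomorphisms can transport.\<close>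

lemma Delta_sandwich:
  assumes "Y \<in> carrier_mat (d + 1) (d + 1)" "i \<le> d" "j \<le> d"
  shows "Delta d i i * Y * Delta d j j = Y $$ (i, j) \<cdot>\<^sub>m (Delta d i j :: 'f::field mat)"
proof (rule eq_matI)
  fix r s assume "r < dim_row (Y $$ (i, j) \<cdot>\<^sub>m (Delta d i j :: 'f mat))"
    "s < dim_col (Y $$ (i, j) \<cdot>\<^sub>m (Delta d i j :: 'f mat))"
  then have rs: "r \<le> d" "s \<le> d"
    by (simp_all add: Delta_def)
  have "(Delta d i i * Y * Delta d j j) $$ (r, s) = (if s = j then (Delta d i i * Y) $$ (r, j) else 0)"
    using assms rs by (intro index_mult_Delta) auto
  also have "\<dots> = (if s = j then (if r = i then Y $$ (i, j) else 0) else 0)"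
    using index_Delta_mult[OF assms(1,2) rs(1) assms(3)] by simp
  finally show "(Delta d i i * Y * Delta d j j) $$ (r, s) = (Y $$ (i, j) \<cdot>\<^sub>m Delta d i j) $$ (r, s)"
    using rs by (simp add: Delta_def)
qed (auto simp: Delta_def)

lemma Delta_neq_zero: "i \<le> d \<Longrightarrow> j \<le> d \<Longrightarrow> Delta d i j \<noteq> (0\<^sub>m (d + 1) (d + 1) :: 'f::field mat)"
proof
  assume "i \<le> d" "j \<le> d" and eq: "Delta d i j = (0\<^sub>m (d + 1) (d + 1) :: 'f mat)"
  have "(Delta d i j :: 'f mat) $$ (i, j) = 0"
    unfolding eq using \<open>i \<le> d\<close> \<open>j \<le> d\<close> by simp
  with \<open>i \<le> d\<close> \<open>j \<le> d\<close> show False by simp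
qed

text \<open>For \<open>r\<close> different from \<open>s\<close>, comparing the entries
  \<open>(r, s)\<close> for the idempotent with index \<open>s\<close> gives
  \<open>D $$ (r, s)\<close> on one side and 0 on the other. Diagonality becomes a multiplicative
  condition, suited to products, inverses and conjugations.\<close>

lemma diagonal_mat_iff_commutes_Delta:
  assumes "D \<in> carrier_mat (d + 1) (d + 1)"
  shows "diagonal_mat D \<longleftrightarrow> (\<forall>i\<le>d. D * Delta d i i = Delta d i i * (D :: 'f::field mat))"
proof
  assume D: "diagonal_mat D"
  show "\<forall>i\<le>d. D * Delta d i i = Delta d i i * D"
  proof (intro allI impI eq_matI)
    fix i r s assume "i \<le> d" "r < dim_row (Delta d i i * D)" "s < dim_col (Delta d i i * D)"
    then have "i \<le> d" "r \<le> d" "s \<le> d"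
      using assms by (auto simp: Delta_def)
    then show "(D * Delta d i i) $$ (r, s) = (Delta d i i * D) $$ (r, s)"
      using D assms
      by (auto simp: index_mult_Delta index_Delta_mult diagonal_mat_def simp del: index_mult_mat(1))
  qed (use assms in \<open>auto simp: Delta_def\<close>)
next
  assume comm: "\<forall>i\<le>d. D * Delta d i i = Delta d i i * D"
  show "diagonal_mat D"
    unfolding diagonal_mat_def
  proof (intro allI impI)
    fix r s assume "r < dim_row D" "s < dim_col D" "r \<noteq> s"
    then have rs: "r \<le> d" "s \<le> d" "r \<noteq> s"
      using assms by auto
    have "(D * Delta d s s) $$ (r, s) = (Delta d s s * D) $$ (r, s)"
      using comm rs by simp
    then show "D $$ (r, s) = 0"
      using assms rs by (simp add: index_mult_Delta index_Delta_mult del: index_mult_mat(1))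
  qed
qed

section \<open>Invertible matrices\<close>

text \<open>Once products are associated to the right, an adjacent inverse pair inside a longer
  product has exactly this shape, so the rule cancels it by rewriting.\<close>

lemma mult_cancel_inverse:
  assumes "P \<in> carrier_mat n n" "Q \<in> carrier_mat n n" "B \<in> carrier_mat n n" "P * Q = 1\<^sub>m n"
  shows "P * (Q * B) = (B :: 'f::field mat)"
  using assms by (simp flip: assoc_mult_mat)

text \<open>All dimensions are tied to one \<open>n\<close>, so that the carrier conditions of the
  rewrite rules are determined. The usual instance is \<open>Suc d\<close>, the form to which
  simplification brings \<open>d + 1\<close>.\<close>

lemmas square_mat_simps =
  mult_carrier_mat[of _ n n _ n] assoc_mult_mat[of _ n n _ n _ n] mult_cancel_inverse[of _ n] for n

text \<open>For square matrices over a field a right inverse is two-sided. This identifies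
  \<open>mat_inv\<close>, defined through an option, with whatever matrix solves the inverse
  equation.\<close>

lemma mat_inv_unique:
  assumes "(P :: 'f::field mat) \<in> carrier_mat n n" "Q \<in> carrier_mat n n" "P * Q = 1\<^sub>m n"
  shows "invertible_mat P" "mat_inv P = Q"
proof -
  have QP: "Q * P = 1\<^sub>m n"
    using assms mat_mult_left_right_inverse by blast
  show "invertible_mat P"
    using assms QP by (auto simp: invertible_mat_def inverts_mat_def)
  have "P \<in> Units (ring_mat TYPE('f) n ())"
    using assms QP by (auto simp: Units_def ring_mat_simps)
  \<comment> \<open>The result \<open>None\<close> would say that \<open>P\<close> is not a
    unit.\<close>
  then obtain B where B: "mat_inverse P = Some B"
    using mat_inverse(1)[OF assms(1)] by fastforce
  then have "P * B = 1\<^sub>m n" "B \<in> carrier_mat n n"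
    using mat_inverse(2)[OF assms(1)] by auto
  then have "Q = B"
    using mult_cancel_inverse[of Q n P B] assms QP by simp
  with B show "mat_inv P = Q"
    by (simp add: mat_inv_def)
qed

lemma mat_inv:
  assumes "(P :: 'f::field mat) \<in> carrier_mat n n" "invertible_mat P"
  shows "mat_inv P \<in> carrier_mat n n" "P * mat_inv P = 1\<^sub>m n" "mat_inv P * P = 1\<^sub>m n"
proof -
  obtain Q where Q: "P * Q = 1\<^sub>m n" "Q * P = 1\<^sub>m (dim_row Q)"
    using assms by (auto simp: invertible_mat_def inverts_mat_def)
  \<comment> \<open>\<open>invertible_mat\<close> does not prescribe the shape of \<open>Q\<close>;
    the two product equations force it.\<close>
  have "dim_col Q = n"
    using arg_cong[OF Q(1), of dim_col] by simp
  moreover have "dim_row Q = n"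
    using arg_cong[OF Q(2), of dim_col] assms(1) by simp
  ultimately have "Q \<in> carrier_mat n n" by blast
  with Q mat_inv_unique[OF assms(1) this] show "mat_inv P \<in> carrier_mat n n"
    "P * mat_inv P = 1\<^sub>m n" "mat_inv P * P = 1\<^sub>m n" by auto
qed

lemma invertible_mat_inv:
  assumes "(P :: 'f::field mat) \<in> carrier_mat n n" "invertible_mat P"
  shows "invertible_mat (mat_inv P)" "mat_inv (mat_inv P) = P"
  using mat_inv_unique[of "mat_inv P" n P] mat_inv[OF assms] assms by auto

lemma invertible_mult:
  assumes "(P :: 'f::field mat) \<in> carrier_mat n n" "invertible_mat P"
    and "Q \<in> carrier_mat n n" "invertible_mat Q"
  shows "invertible_mat (P * Q)" "mat_inv (P * Q) = mat_inv Q * mat_inv P"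
proof -
  note P = mat_inv[OF assms(1,2)] and Q = mat_inv[OF assms(3,4)]
  have "P * Q * (mat_inv Q * mat_inv P) = P * (Q * (mat_inv Q * mat_inv P))"
    using P Q assms by (intro assoc_mult_mat) auto
  also have "\<dots> = 1\<^sub>m n"
    using P Q assms by (simp add: mult_cancel_inverse[of Q n "mat_inv Q"])
  finally have "P * Q * (mat_inv Q * mat_inv P) = 1\<^sub>m n" .
  then show "invertible_mat (P * Q)" "mat_inv (P * Q) = mat_inv Q * mat_inv P"
    using mat_inv_unique[of "P * Q" n "mat_inv Q * mat_inv P"] assms P Q by auto
qed

lemma invertible_transpose:
  assumes "(P :: 'f::field mat) \<in> carrier_mat n n" "invertible_mat P"
  shows "invertible_mat (transpose_mat P)" "mat_inv (transpose_mat P) = transpose_mat (mat_inv P)"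
proof -
  note P = mat_inv[OF assms]
  have "transpose_mat P * transpose_mat (mat_inv P) = transpose_mat (mat_inv P * P)"
    using transpose_mult[OF P(1) assms(1)] by simp
  then have "transpose_mat P * transpose_mat (mat_inv P) = 1\<^sub>m n"
    using P by simp
  then show "invertible_mat (transpose_mat P)" "mat_inv (transpose_mat P) = transpose_mat (mat_inv P)"
    using mat_inv_unique[of "transpose_mat P" n "transpose_mat (mat_inv P)"] assms P by auto
qed

section \<open>Inner endomorphisms and simultaneous diagonalization\<close>

text \<open>If \<open>P *\<^sub>v c\<close> vanishes, applying \<open>F j\<close> leaves the
  \<open>j\<close>-th coefficient of \<open>c\<close> times the nonzero vector \<open>w j\<close>.
  So every coefficient is zero and \<open>det P\<close> is nonzero. Both constructions of a
  conjugating matrix below rely on this.\<close>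

lemma invertible_if_separated:
  assumes P: "(P :: 'f::field mat) \<in> carrier_mat n n"
    and F: "\<And>j. j < n \<Longrightarrow> F j \<in> carrier_mat n n"
    and w: "\<And>j. j < n \<Longrightarrow> w j \<in> carrier_vec n \<and> w j \<noteq> 0\<^sub>v n"
    and sep: "\<And>j k. j < n \<Longrightarrow> k < n \<Longrightarrow> F j *\<^sub>v col P k = (if j = k then w j else 0\<^sub>v n)"
  shows "invertible_mat P"
proof -
  have "c = 0\<^sub>v n" if c: "c \<in> carrier_vec n" "P *\<^sub>v c = 0\<^sub>v n" for c
  proof
    fix j assume "j < dim_vec (0\<^sub>v n :: 'f vec)"
    then have j: "j < n" by simp
    obtain r where r: "r < n" "w j $ r \<noteq> 0"
      using w[OF j] by (metis carrier_vecD eq_vecI index_zero_vec)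
    have "(F j * P) *\<^sub>v c = F j *\<^sub>v 0\<^sub>v n"
      using c F[OF j] P by simp
    also have "\<dots> = 0\<^sub>v n"
      using F[OF j] by (intro eq_vecI) auto
    finally have "(F j * P) *\<^sub>v c = 0\<^sub>v n" .
    then have "0 = ((F j * P) *\<^sub>v c) $ r"
      using r by simp
    also have "\<dots> = (\<Sum>k = 0..<n. (F j * P) $$ (r, k) * c $ k)"
      using r F[OF j] P c by (simp add: mult_mat_vec_def scalar_prod_def)
    also have "\<dots> = (\<Sum>k = 0..<n. if k = j then w j $ r * c $ j else 0)"
    proof (intro sum.cong refl)
      fix k assume k: "k \<in> {0..<n}"
      have "(F j * P) $$ (r, k) = (F j *\<^sub>v col P k) $ r"
        using r k F[OF j] P by simp
      then show "(F j * P) $$ (r, k) * c $ k = (if k = j then w j $ r * c $ j else 0)"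
        using sep[OF j, of k] k r by (auto simp del: index_mult_mat)
    qed
    finally show "c $ j = 0\<^sub>v n $ j"
      using j r by simp
  qed (use c in simp)
  then have "det P \<noteq> 0"
    using det_0_iff_vec_prod_zero_field[OF P] by blast
  then have "P \<in> Units (ring_mat TYPE('f) n ())"
    by (rule det_non_zero_imp_unit[OF P])
  then show ?thesis
    using mat_inv_unique(1)[OF P] by (auto simp: Units_def ring_mat_simps)
qed

lemma nonzero_mat_obtain_col:
  assumes "A \<in> carrier_mat n m" "A \<noteq> 0\<^sub>m n m"
  obtains s where "s < m" "col A s \<noteq> 0\<^sub>v n"
  using assms mat_col_eqI[of "0\<^sub>m n m" A] by fastforce

text \<open>Each idempotent fixes its own columns and kills those of the others. One nonzero column
  from each gives a \<open>P\<close> with \<open>E i * P = P * Delta d i i\<close>, and the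
  idempotents themselves separate the columns of \<open>P\<close>, which makes it
  invertible.\<close>

lemma orthogonal_idempotents_diagonalizable:
  fixes E :: "nat \<Rightarrow> 'f::field mat"
  assumes E: "\<And>i. i \<le> d \<Longrightarrow> E i \<in> carrier_mat (d + 1) (d + 1) \<and> E i \<noteq> 0\<^sub>m (d + 1) (d + 1)"
    and orth: "\<And>i j. i \<le> d \<Longrightarrow> j \<le> d \<Longrightarrow> E i * E j = (if i = j then E i else 0\<^sub>m (d + 1) (d + 1))"
  shows "\<exists>P\<in>carrier_mat (d + 1) (d + 1). invertible_mat P \<and>
           (\<forall>i\<le>d. E i = P * Delta d i i * mat_inv P)"
proof -
  have "\<exists>s<d + 1. col (E i) s \<noteq> 0\<^sub>v (d + 1)" if "i \<le> d" for i
    using nonzero_mat_obtain_col[of "E i" "d + 1" "d + 1"] E[OF that] by metis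
  then obtain s where s: "\<And>i. i \<le> d \<Longrightarrow> s i < d + 1 \<and> col (E i) (s i) \<noteq> 0\<^sub>v (d + 1)"
    by metis
  define P where "P = mat (d + 1) (d + 1) (\<lambda>(r, k). E k $$ (r, s k))"
  have P: "P \<in> carrier_mat (d + 1) (d + 1)"
    by (simp add: P_def)
  have colP: "col P k = col (E k) (s k)" if "k \<le> d" for k
    using E[OF that] s[OF that] that by (intro eq_vecI) (auto simp: P_def)
  have act: "E j *\<^sub>v col P k = (if j = k then col (E j) (s j) else 0\<^sub>v (d + 1))"
    if "j \<le> d" "k \<le> d" for j k
  proof -
    have "E j *\<^sub>v col P k = col (E j * E k) (s k)"
      using E[OF that(1)] E[OF that(2)] s[OF that(2)] colP[OF that(2)] by auto
    also have "\<dots> = (if j = k then col (E j) (s j) else 0\<^sub>v (d + 1))"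
      using orth[OF that] s[OF that(2)] by (cases "j = k") auto
    finally show ?thesis .
  qed
  have inv: "invertible_mat P"
    by (rule invertible_if_separated[OF P, of E "\<lambda>j. col (E j) (s j)"])
      (use E s act in \<open>auto simp: less_Suc_eq_le intro!: col_carrier_vec[of _ "Suc d"]\<close>)
  note Q = mat_inv[OF P inv]
  have "E i = P * Delta d i i * mat_inv P" if i: "i \<le> d" for i
  proof -
    have "E i * P = P * Delta d i i"
    proof (rule eq_matI)
      fix r k assume "r < dim_row (P * Delta d i i)" "k < dim_col (P * Delta d i i)"
      then have rk: "r \<le> d" "k \<le> d"
        using P by (auto simp: Delta_def)
      have "(E i * P) $$ (r, k) = (E i *\<^sub>v col P k) $ r"
        using E[OF i, THEN conjunct1] P rk by simp
      also have "\<dots> = (if k = i then P $$ (r, i) else 0)"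
        using act[OF i rk(2)] rk E[OF i] s[OF i] by (auto simp: P_def)
      finally show "(E i * P) $$ (r, k) = (P * Delta d i i) $$ (r, k)"
        using P i rk by (simp add: index_mult_Delta del: index_mult_mat(1))
    qed (use E[OF i] P in \<open>auto simp: Delta_def\<close>)
    then have "E i * (P * mat_inv P) = P * Delta d i i * mat_inv P"
      using E[OF i] P Q by (metis assoc_mult_mat)
    then show ?thesis
      using Q E[OF i, THEN conjunct1] by simp
  qed
  with P inv show ?thesis by blast
qed

text \<open>Skolem--Noether. If column \<open>s\<close> of \<open>\<phi> \<Delta>\<^sub>0\<^sub>0\<close> is nonzero, the columns \<open>u\<^sub>k\<close> with index \<open>s\<close> of the
  \<open>\<phi> \<Delta>\<^sub>k\<^sub>0\<close> satisfy \<open>\<phi> \<Delta>\<^sub>i\<^sub>j u\<^sub>k = \<delta>\<^sub>j\<^sub>k u\<^sub>i\<close>, so they form an invertible \<open>P\<close> with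
  \<open>\<phi> \<Delta>\<^sub>i\<^sub>j P = P \<Delta>\<^sub>i\<^sub>j\<close>. Applying \<open>\<phi>\<close> to \<open>\<Delta>\<^sub>i\<^sub>i Y \<Delta>\<^sub>j\<^sub>j = Y\<^sub>i\<^sub>j \<Delta>\<^sub>i\<^sub>j\<close> then reads off the entries of
  \<open>P\<^sup>-\<^sup>1 \<phi>(Y) P\<close>, which avoids expanding \<open>Y\<close> as a sum.\<close>

lemma mat_endomorphism_inner:
  fixes d :: nat and \<phi> :: "'f::field mat \<Rightarrow> 'f mat"
  defines "M \<equiv> carrier_mat (d + 1) (d + 1)"
  assumes closed: "\<And>Y. Y \<in> M \<Longrightarrow> \<phi> Y \<in> M"
    and smult: "\<And>c Y. Y \<in> M \<Longrightarrow> \<phi> (c \<cdot>\<^sub>m Y) = c \<cdot>\<^sub>m \<phi> Y"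
    and mult: "\<And>Y Z. Y \<in> M \<Longrightarrow> Z \<in> M \<Longrightarrow> \<phi> (Y * Z) = \<phi> Y * \<phi> Z"
    and nonzero: "\<phi> (Delta d 0 0) \<noteq> 0\<^sub>m (d + 1) (d + 1)"
  shows "\<exists>P\<in>M. invertible_mat P \<and> (\<forall>Y\<in>M. \<phi> Y = P * Y * mat_inv P)"
proof -
  define F where "F i j = \<phi> (Delta d i j)" for i j
  have F: "F i j \<in> carrier_mat (d + 1) (d + 1)" for i j
    using closed by (simp add: F_def M_def)
  \<comment> \<open>Preservation of zero comes from homogeneity with the scalar 0.\<close>
  have zero: "\<phi> (0\<^sub>m (d + 1) (d + 1)) = 0\<^sub>m (d + 1) (d + 1)"
  proof -
    have "\<phi> (0 \<cdot>\<^sub>m Delta d 0 0) = 0 \<cdot>\<^sub>m F 0 0"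
      using smult by (simp add: F_def M_def)
    moreover have "0 \<cdot>\<^sub>m A = 0\<^sub>m (d + 1) (d + 1)" if "A \<in> M" for A :: "'f mat"
      using that by (intro eq_matI) (auto simp: M_def)
    ultimately show ?thesis
      using F by (simp add: M_def)
  qed
  have FF: "F i j * F k l = (if j = k then F i l else 0\<^sub>m (d + 1) (d + 1))"
    if "j \<le> d" "k \<le> d" for i j k l
    using mult[of "Delta d i j" "Delta d k l"] that zero
    by (simp add: F_def M_def Delta_mult_Delta split: if_splits)
  obtain s where s: "s < d + 1" "col (F 0 0) s \<noteq> 0\<^sub>v (d + 1)"
    using nonzero_mat_obtain_col[OF F, of 0 0] nonzero unfolding F_def by blast
  define P where "P = mat (d + 1) (d + 1) (\<lambda>(r, k). F k 0 $$ (r, s))"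
  have P: "P \<in> carrier_mat (d + 1) (d + 1)"
    by (simp add: P_def)
  have colP: "col P k = col (F k 0) s" if "k \<le> d" for k
    using F[of k 0] s that by (intro eq_vecI) (auto simp: P_def)
  have act: "F i j *\<^sub>v col P k = (if j = k then col (F i 0) s else 0\<^sub>v (d + 1))"
    if "j \<le> d" "k \<le> d" for i j k
  proof -
    have "F i j *\<^sub>v col P k = col (F i j * F k 0) s"
      using F[of i j] F[of k 0] s colP[OF that(2)] by auto
    also have "\<dots> = (if j = k then col (F i 0) s else 0\<^sub>v (d + 1))"
      using FF[OF that] s by (cases "j = k") auto
    finally show ?thesis .
  qed
  have inv: "invertible_mat P"
    by (rule invertible_if_separated[OF P, of "\<lambda>j. F 0 j" "\<lambda>j. col (F 0 0) s"])
      (use F s act in \<open>auto intro!: col_carrier_vec\<close>)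
  define Q where "Q = mat_inv P"
  have Q: "Q \<in> carrier_mat (d + 1) (d + 1)" "P * Q = 1\<^sub>m (d + 1)" "Q * P = 1\<^sub>m (d + 1)"
    using mat_inv[OF P inv] by (simp_all add: Q_def)
  have FP: "F i j * P = P * Delta d i j" if "i \<le> d" "j \<le> d" for i j
  proof (rule eq_matI)
    fix r k assume "r < dim_row (P * Delta d i j)" "k < dim_col (P * Delta d i j)"
    then have rk: "r \<le> d" "k \<le> d"
      using P by (auto simp: Delta_def)
    have "(F i j * P) $$ (r, k) = (F i j *\<^sub>v col P k) $ r"
      using F[of i j] P rk by simp
    also have "\<dots> = (if k = j then P $$ (r, i) else 0)"
      using act[OF that(2) rk(2)] rk F[of i 0] s that by (auto simp: P_def)
    finally show "(F i j * P) $$ (r, k) = (P * Delta d i j) $$ (r, k)"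
      using P that rk by (simp add: index_mult_Delta del: index_mult_mat(1))
  qed (use F[of i j] P in \<open>auto simp: Delta_def\<close>)
  have "\<phi> Y = P * Y * Q" if Y: "Y \<in> M" for Y
  proof -
    define W where "W = Q * \<phi> Y * P"
    have Yc: "Y \<in> carrier_mat (d + 1) (d + 1)" and fY: "\<phi> Y \<in> carrier_mat (d + 1) (d + 1)"
      using Y closed by (auto simp: M_def)
    have W: "W \<in> carrier_mat (d + 1) (d + 1)"
      using Q P fY by (auto simp: W_def)
    have "W $$ (i, j) = Y $$ (i, j)" if ij: "i \<le> d" "j \<le> d" for i j
    proof -
      \<comment> \<open>Multiplying \<open>F i i * P = P * Delta d i i\<close> by \<open>Q\<close>
        on both sides turns it into a rule for moving \<open>Q\<close> past
        \<open>F i i\<close>.\<close>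
      have QF: "Q * F i i = Delta d i i * Q"
      proof -
        have "Q * (F i i * P) * Q = Q * (P * Delta d i i) * Q"
          using FP ij by simp
        then show ?thesis
          using Q P F[of i i]
          by (simp add: square_mat_simps[where n = "Suc d"])
      qed
      have "\<phi> (Delta d i i * Y * Delta d j j) = F i i * \<phi> Y * F j j"
        using mult[of "Delta d i i * Y" "Delta d j j"] mult[of "Delta d i i" Y] Yc
        by (simp add: M_def F_def square_mat_simps(1)[where n = "Suc d"] del: assoc_mult_mat)
      then have "Y $$ (i, j) \<cdot>\<^sub>m F i j = F i i * \<phi> Y * F j j"
        using smult Delta_sandwich[OF Yc ij] by (simp add: M_def F_def)
      \<comment> \<open>Multiplying by \<open>Q\<close> and \<open>P\<close> turns both sides into
        multiples of the same \<open>Delta d i j\<close>, with coefficients from \<open>Y\<close>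
        and from \<open>W\<close>.\<close>
      then have "Q * (Y $$ (i, j) \<cdot>\<^sub>m F i j) * P = Q * (F i i * \<phi> Y * F j j) * P"
        by simp
      also have "\<dots> = (Q * F i i) * \<phi> Y * (F j j * P)"
        using Q P fY F[of i i] F[of j j] by (simp add: square_mat_simps[where n = "Suc d"])
      also have "\<dots> = Delta d i i * W * Delta d j j"
        using Q P fY FP[OF ij(2) ij(2)] QF
        by (simp add: square_mat_simps[where n = "Suc d"] W_def)
      also have "\<dots> = W $$ (i, j) \<cdot>\<^sub>m Delta d i j"
        using Delta_sandwich[OF W ij] .
      also have "Q * (Y $$ (i, j) \<cdot>\<^sub>m F i j) * P = Y $$ (i, j) \<cdot>\<^sub>m (Q * (F i j * P))"
        using Q P F[of i j] by (simp add: square_mat_simps[where n = "Suc d"]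
            mult_smult_distrib[of _ "d+1" "d+1" _ "d+1"] mult_smult_assoc_mat[of _ "d+1" "d+1" _ "d+1"])
      also have "\<dots> = Y $$ (i, j) \<cdot>\<^sub>m Delta d i j"
        using FP[OF ij] mult_cancel_inverse[OF Q(1) P Delta_carrier Q(3)] by simp
      finally have "(Y $$ (i, j) \<cdot>\<^sub>m Delta d i j) $$ (i, j) = (W $$ (i, j) \<cdot>\<^sub>m Delta d i j) $$ (i, j)"
        by simp
      then show ?thesis
        using ij by (simp add: Delta_def)
    qed
    then have "W = Y"
      using W Yc by (intro eq_matI) auto
    moreover have "P * W * Q = \<phi> Y"
      using Q P fY by (simp add: W_def square_mat_simps[where n = "Suc d"])
    ultimately show ?thesis by simp
  qed
  with P inv show ?thesis
    unfolding M_def Q_def by blast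
qed

section \<open>Isomorphisms and ranks\<close>

text \<open>A nonzero column alone is linearly independent, which forces the rank to be at least
  1.\<close>

lemma rank_eq_0_iff:
  assumes "(A :: 'f::field mat) \<in> carrier_mat n m"
  shows "vec_space.rank n A = 0 \<longleftrightarrow> A = 0\<^sub>m n m"
proof
  interpret vec_space "TYPE('f)" n .
  assume rank: "rank A = 0"
  show "A = 0\<^sub>m n m"
  proof (rule ccontr)
    assume "A \<noteq> 0\<^sub>m n m"
    then obtain s where s: "s < m" "col A s \<noteq> 0\<^sub>v n"
      using nonzero_mat_obtain_col assms by blast
    have carrier: "col A s \<in> carrier_vec n"
      using assms by auto
    have "lin_indpt {col A s}"
    proof
      assume "lin_dep {col A s}"
      then obtain B a v where B: "B \<subseteq> {col A s}" "lincomb a B = 0\<^sub>v n" "v \<in> B" "a v \<noteq> 0"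
        by (auto simp: lin_dep_def)
      then have "B = {col A s}" "v = col A s" by auto
      then have "a v \<cdot>\<^sub>v col A s = 0\<^sub>v n"
        using B(2) carrier by (simp add: lincomb_def)
      then have "inverse (a v) \<cdot>\<^sub>v (a v \<cdot>\<^sub>v col A s) = 0\<^sub>v n"
        by simp
      with s B(4) show False
        by (simp add: smult_smult_assoc)
    qed
    moreover have "{col A s} \<subseteq> set (cols A)"
      using s assms by (simp add: cols_def)
    ultimately show False
      using rank_ge_card_indpt[OF assms, of "{col A s}"] rank by simp
  qed
qed (simp add: vec_space.rank_0I)

text \<open>The entries are those of an outer product, so the rank is at most 1. It is not 0, since
  undoing the conjugation would turn a zero matrix into a zero \<open>Delta d i i\<close>.\<close>

lemma rank_conj_Delta:
  assumes "(P :: 'f::field mat) \<in> carrier_mat (d + 1) (d + 1)" "invertible_mat P" "i \<le> d"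
  shows "vec_space.rank (d + 1) (P * Delta d i i * mat_inv P) = 1"
proof -
  let ?E = "P * Delta d i i * mat_inv P"
  note Q = mat_inv[OF assms(1,2)]
  have E: "?E \<in> carrier_mat (d + 1) (d + 1)"
    using assms Q by auto
  have "vec_space.rank (d + 1) ?E \<le> 1"
  proof (rule vec_space.rank_le_1_product_entries[OF E])
    fix r s assume "r < dim_row ?E" "s < dim_col ?E"
    then have "r \<le> d" "s \<le> d"
      using E by auto
    then show "?E $$ (r, s) = P $$ (r, i) * mat_inv P $$ (i, s)"
      using index_mult_Delta_mult[OF assms(1) Q(1)] assms(3) by simp
  qed
  moreover have "?E \<noteq> 0\<^sub>m (d + 1) (d + 1)"
  proof
    assume zero: "?E = 0\<^sub>m (d + 1) (d + 1)"
    have "Delta d i i = mat_inv P * ?E * P"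
      using assms Q
      by (simp add: square_mat_simps[where n = "Suc d"])
    also have "\<dots> = 0\<^sub>m (d + 1) (d + 1)"
      unfolding zero using assms Q by simp
    finally show False
      using Delta_neq_zero[OF assms(3,3)] by blast
  qed
  ultimately show ?thesis
    using rank_eq_0_iff[OF E] by linarith
qed

section \<open>Isomorphisms of algebras with matrix algebras\<close>

lemma mat_algebra_simps [simp]:
  "carrier (mat_algebra n :: ('f::field, 'f mat) module) = carrier_mat n n"
  "mult (mat_algebra n :: ('f, 'f mat) module) = (*)"
  "one (mat_algebra n :: ('f, 'f mat) module) = 1\<^sub>m n"
  "zero (mat_algebra n :: ('f, 'f mat) module) = 0\<^sub>m n n"
  "add (mat_algebra n :: ('f, 'f mat) module) = (+)"
  "smult (mat_algebra n :: ('f, 'f mat) module) = (\<cdot>\<^sub>m)"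
  by (simp_all add: module_mat_simps)

lemma algebra_isoD:
  assumes "\<phi> \<in> algebra_iso A B"
  shows "\<phi> \<in> ring_iso A B"
    and "bij_betw \<phi> (carrier A) (carrier B)"
    and "inj_on \<phi> (carrier A)"
    and "x \<in> carrier A \<Longrightarrow> \<phi> x \<in> carrier B"
    and "x \<in> carrier A \<Longrightarrow> y \<in> carrier A \<Longrightarrow> \<phi> (x \<otimes>\<^bsub>A\<^esub> y) = \<phi> x \<otimes>\<^bsub>B\<^esub> \<phi> y"
    and "x \<in> carrier A \<Longrightarrow> y \<in> carrier A \<Longrightarrow> \<phi> (x \<oplus>\<^bsub>A\<^esub> y) = \<phi> x \<oplus>\<^bsub>B\<^esub> \<phi> y"
    and "\<phi> \<one>\<^bsub>A\<^esub> = \<one>\<^bsub>B\<^esub>"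
    and "x \<in> carrier A \<Longrightarrow> \<phi> (c \<odot>\<^bsub>A\<^esub> x) = c \<odot>\<^bsub>B\<^esub> \<phi> x"
proof -
  show *: "\<phi> \<in> ring_iso A B"
    using assms by (simp add: algebra_iso_def)
  show "bij_betw \<phi> (carrier A) (carrier B)"
    by (rule ring_iso_memE(5)[OF *])
  then show "inj_on \<phi> (carrier A)"
    by (rule bij_betw_imp_inj_on)
qed (use assms in \<open>auto simp: algebra_iso_def dest: ring_iso_memE\<close>)

lemma algebra_iso_comp:
  assumes "\<phi> \<in> algebra_iso A B" "\<psi> \<in> algebra_iso B C"
  shows "\<psi> \<circ> \<phi> \<in> algebra_iso A C"
  using assms ring_iso_set_trans[of \<phi> A B \<psi> C] ring_iso_memE(1)[of \<phi> A B]
  by (auto simp: algebra_iso_def)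

lemma algebra_iso_inv:
  fixes A :: "('f::field, 'a) module"
  assumes "assoc_algebra A" "\<phi> \<in> algebra_iso A B"
  shows "inv_into (carrier A) \<phi> \<in> algebra_iso B A"
proof -
  interpret M: Module.module "class_ring :: 'f ring" A
    using assms(1) by (simp add: assoc_algebra_def)
  let ?\<psi> = "inv_into (carrier A) \<phi>"
  note \<phi> = algebra_isoD[OF assms(2)]
  have "?\<psi> \<in> ring_iso B A"
    using assms \<phi>(1) ring_iso_set_sym by (auto simp: assoc_algebra_def)
  moreover have "?\<psi> (c \<odot>\<^bsub>B\<^esub> y) = c \<odot>\<^bsub>A\<^esub> ?\<psi> y" if "y \<in> carrier B" for c y
  proof -
    have "y \<in> \<phi> ` carrier A"
      using that bij_betw_imp_surj_on[OF \<phi>(2)] by simp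
    then obtain x where x: "x \<in> carrier A" "y = \<phi> x"
      by blast
    then have "c \<odot>\<^bsub>B\<^esub> y = \<phi> (c \<odot>\<^bsub>A\<^esub> x)"
      using \<phi>(8) by simp
    then show ?thesis
      using x \<phi>(3) M.smult_closed[of c x] by (simp add: inv_into_f_f)
  qed
  ultimately show ?thesis
    by (simp add: algebra_iso_def)
qed

lemma algebra_iso_zero:
  assumes "assoc_algebra A" "assoc_algebra B" "\<phi> \<in> algebra_iso A B"
  shows "\<phi> \<zero>\<^bsub>A\<^esub> = \<zero>\<^bsub>B\<^esub>"
  using assms algebra_isoD(1)[OF assms(3)] ring_hom_zero[of \<phi> A B]
  by (auto simp: assoc_algebra_def ring_iso_def)

lemma assoc_algebra_mat: "assoc_algebra (mat_algebra n :: ('f::field, 'f mat) module)"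
proof -
  interpret abelian_group "mat_algebra n :: ('f, 'f mat) module"
    by (rule abelian_group_mat)
  have "ring (mat_algebra n :: ('f, 'f mat) module)"
    by unfold_locales (auto simp: add_mult_distrib_mat mult_add_distrib_mat)
  moreover have "Module.module (class_ring :: 'f ring) (mat_algebra n :: ('f, 'f mat) module)"
    by unfold_locales (auto simp: add_smult_distrib_right_mat add_smult_distrib_left_mat ac_simps class_ring_simps)
  ultimately show ?thesis
    by (auto simp: assoc_algebra_def)
qed

lemma id_algebra_iso: "id \<in> algebra_iso A A"
  using ring_iso_set_refl by (auto simp: algebra_iso_def)

lemma is_mat_algebra_mat: "is_mat_algebra n (mat_algebra n :: ('f::field, 'f mat) module)"
  using assoc_algebra_mat id_algebra_iso by (auto simp: is_mat_algebra_def)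

lemma conj_algebra_iso:
  assumes "(P :: 'f::field mat) \<in> carrier_mat n n" "invertible_mat P"
  shows "(\<lambda>Y. P * Y * mat_inv P) \<in> algebra_iso (mat_algebra n) (mat_algebra n)"
proof -
  note Q = mat_inv[OF assms]
  have "bij_betw (\<lambda>Y. P * Y * mat_inv P) (carrier_mat n n) (carrier_mat n n)"
    by (rule bij_betw_byWitness[of _ "\<lambda>Y. mat_inv P * Y * P"])
      (use assms Q in \<open>auto simp: square_mat_simps[where n = n]\<close>)
  then show ?thesis
    unfolding algebra_iso_def using assms Q
    by (auto intro!: ring_iso_memI simp: square_mat_simps[where n = n] mult_add_distrib_mat[of _ n n] add_mult_distrib_mat[of _ n n]
        mult_smult_distrib[of _ n n _ n] mult_smult_assoc_mat[of _ n n _ n])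
qed

text \<open>Skolem--Noether for automorphisms: injectivity supplies the nonvanishing at
  \<open>Delta d 0 0\<close>.\<close>

lemma algebra_iso_mat_inner:
  fixes \<phi> :: "'f::field mat \<Rightarrow> 'f mat"
  assumes "\<phi> \<in> algebra_iso (mat_algebra (d + 1)) (mat_algebra (d + 1))"
  obtains P where "P \<in> carrier_mat (d + 1) (d + 1)" "invertible_mat P"
    "\<And>Y. Y \<in> carrier_mat (d + 1) (d + 1) \<Longrightarrow> \<phi> Y = P * Y * mat_inv P"
proof -
  note \<phi> = algebra_isoD[OF assms]
  have "\<phi> (Delta d 0 0) \<noteq> \<phi> (0\<^sub>m (d + 1) (d + 1))"
    using \<phi>(3) Delta_neq_zero[of 0 d 0] by (auto dest!: inj_onD)
  then have "\<phi> (Delta d 0 0) \<noteq> 0\<^sub>m (d + 1) (d + 1)"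
    using algebra_iso_zero[OF assoc_algebra_mat assoc_algebra_mat assms] by simp
  then show ?thesis
    using mat_endomorphism_inner[of d \<phi>] \<phi>(4,5,8) that by auto
qed

text \<open>Frees the rank condition from the isomorphism chosen inside \<open>alg_rank\<close>: any
  \<open>\<phi>\<close> may be used to test it. From left to right, rank 1 makes each image nonzero
  and simultaneous diagonalization applies. From right to left, the chosen isomorphism differs from
  \<open>\<phi>\<close> by an inner automorphism, which again yields conjugates of the matrix
  units.\<close>

lemma orth_rank1_idempotents_iff:
  fixes A :: "('f::field, 'a) module"
  assumes A: "assoc_algebra A" and \<phi>: "\<phi> \<in> algebra_iso A (mat_algebra (d + 1))"
  shows "orth_rank1_idempotents d A E \<longleftrightarrow>
    (\<exists>P\<in>carrier_mat (d + 1) (d + 1). invertible_mat P \<and>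
      (\<forall>i\<le>d. E i \<in> carrier A \<and> \<phi> (E i) = P * Delta d i i * mat_inv P))"
proof -
  \<comment> \<open>The isomorphism with which \<open>alg_rank\<close> measures.\<close>
  define \<chi> where "\<chi> = (SOME \<phi>. \<phi> \<in> algebra_iso A (mat_algebra (d + 1)))"
  have \<chi>: "\<chi> \<in> algebra_iso A (mat_algebra (d + 1))"
    unfolding \<chi>_def using someI[of "\<lambda>\<phi>. \<phi> \<in> algebra_iso A (mat_algebra (d + 1))" \<phi>] \<phi> by simp
  have rank: "alg_rank (d + 1) A x = vec_space.rank (d + 1) (\<chi> x)" for x
    by (simp add: alg_rank_def \<chi>_def)
  note zero = algebra_iso_zero[OF A assoc_algebra_mat]
  interpret ring A
    using A by (simp add: assoc_algebra_def)
  show ?thesis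
  proof
    assume E: "orth_rank1_idempotents d A E"
    then have carrier: "E i \<in> carrier A" if "i \<le> d" for i
      using that by (auto simp: orth_rank1_idempotents_def)
    have "\<phi> (E i) \<noteq> 0\<^sub>m (d + 1) (d + 1)" if "i \<le> d" for i
    proof
      assume "\<phi> (E i) = 0\<^sub>m (d + 1) (d + 1)"
      then have "\<phi> (E i) = \<phi> \<zero>\<^bsub>A\<^esub>"
        using zero[OF \<phi>] by simp
      then have "E i = \<zero>\<^bsub>A\<^esub>"
        using algebra_isoD(3)[OF \<phi>] carrier[OF that] by (auto dest: inj_onD)
      then have "vec_space.rank (d + 1) (\<chi> (E i)) = 0"
        using zero[OF \<chi>] by (simp add: vec_space.rank_0I)
      then show False
        using E that rank by (simp add: orth_rank1_idempotents_def)
    qed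
    moreover have "\<phi> (E i) * \<phi> (E j) = (if i = j then \<phi> (E i) else 0\<^sub>m (d + 1) (d + 1))"
      if "i \<le> d" "j \<le> d" for i j
    proof -
      have "\<phi> (E i) * \<phi> (E j) = \<phi> (E i \<otimes>\<^bsub>A\<^esub> E j)"
        using algebra_isoD(5)[OF \<phi>] carrier that by simp
      then show ?thesis
        using E that zero[OF \<phi>] by (simp add: orth_rank1_idempotents_def)
    qed
    moreover have "\<phi> (E i) \<in> carrier_mat (d + 1) (d + 1)" if "i \<le> d" for i
      using algebra_isoD(4)[OF \<phi>] carrier[OF that] by simp
    ultimately show "\<exists>P\<in>carrier_mat (d + 1) (d + 1). invertible_mat P \<and>
      (\<forall>i\<le>d. E i \<in> carrier A \<and> \<phi> (E i) = P * Delta d i i * mat_inv P)"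
      using orthogonal_idempotents_diagonalizable[of d "\<lambda>i. \<phi> (E i)"] carrier by auto
  next
    assume "\<exists>P\<in>carrier_mat (d + 1) (d + 1). invertible_mat P \<and>
      (\<forall>i\<le>d. E i \<in> carrier A \<and> \<phi> (E i) = P * Delta d i i * mat_inv P)"
    then obtain P where P: "P \<in> carrier_mat (d + 1) (d + 1)" "invertible_mat P"
      and E: "\<And>i. i \<le> d \<Longrightarrow> E i \<in> carrier A \<and> \<phi> (E i) = P * Delta d i i * mat_inv P"
      by blast
    note Q = mat_inv[OF P]
    obtain T where T: "T \<in> carrier_mat (d + 1) (d + 1)" "invertible_mat T"
      and inner: "\<And>Y. Y \<in> carrier_mat (d + 1) (d + 1) \<Longrightarrow>
        (\<chi> \<circ> inv_into (carrier A) \<phi>) Y = T * Y * mat_inv T"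
      by (rule algebra_iso_mat_inner[OF algebra_iso_comp[OF algebra_iso_inv[OF A \<phi>] \<chi>]], rule that)
    have "vec_space.rank (d + 1) (\<chi> (E i)) = 1" if i: "i \<le> d" for i
    proof -
      have "\<chi> (E i) = (\<chi> \<circ> inv_into (carrier A) \<phi>) (\<phi> (E i))"
        using algebra_isoD(3)[OF \<phi>] E[OF i, THEN conjunct1] by (simp add: inv_into_f_f)
      also have "\<dots> = T * (P * Delta d i i * mat_inv P) * mat_inv T"
        using inner E[OF i] algebra_isoD(4)[OF \<phi>, of "E i"] by simp
      also have "\<dots> = (T * P) * Delta d i i * mat_inv (T * P)"
        using mat_inv[OF T] T P Q
        by (simp add: invertible_mult[OF T P] square_mat_simps[where n = "Suc d"])
      finally show ?thesis
        using rank_conj_Delta[of "T * P" d i] invertible_mult[OF T P] T P i by simp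
    qed
    moreover have "E i \<otimes>\<^bsub>A\<^esub> E j = (if i = j then E i else \<zero>\<^bsub>A\<^esub>)" if ij: "i \<le> d" "j \<le> d" for i j
    proof (rule inj_onD[OF algebra_isoD(3)[OF \<phi>]])
      have "\<phi> (E i \<otimes>\<^bsub>A\<^esub> E j) = P * Delta d i i * mat_inv P * (P * Delta d j j * mat_inv P)"
        using algebra_isoD(5)[OF \<phi>] E ij by simp
      also have "\<dots> = P * (Delta d i i * Delta d j j) * mat_inv P"
        using P Q
        by (simp add: square_mat_simps[where n = "Suc d"])
      also have "\<dots> = \<phi> (if i = j then E i else \<zero>\<^bsub>A\<^esub>)"
        using ij P Q E zero[OF \<phi>] by (simp add: Delta_mult_Delta)
      finally show "\<phi> (E i \<otimes>\<^bsub>A\<^esub> E j) = \<phi> (if i = j then E i else \<zero>\<^bsub>A\<^esub>)" .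
    qed (use E ij in auto)
    ultimately show "orth_rank1_idempotents d A E"
      unfolding orth_rank1_idempotents_def rank using E by (intro conjI allI impI) blast+
  qed
qed

section \<open>Transport along isomorphisms\<close>

text \<open>An isomorphism \<open>\<phi>\<close> from \<open>B\<close> to matrices, composed with
  \<open>\<chi>\<close>, is one from \<open>A\<close>, so the same diagonalizing matrix certifies
  rank 1 idempotents on both sides. The nonzero triple products survive by injectivity.\<close>

lemma idempotent_system_transport:
  fixes A :: "('f::field, 'a) module" and B :: "('f, 'b) module"
  assumes sys: "idempotent_system d (A, E, Es)" and B: "is_mat_algebra (d + 1) B"
    and \<chi>: "\<chi> \<in> algebra_iso A B" "\<And>i. i \<le> d \<Longrightarrow> \<chi> (E i) = F i \<and> \<chi> (Es i) = Fs i"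
  shows "idempotent_system d (B, F, Fs)"
proof -
  have A: "assoc_algebra A" and B': "assoc_algebra B"
    using sys B by (auto simp: idempotent_system_def is_mat_algebra_def)
  interpret ring A
    using A by (simp add: assoc_algebra_def)
  obtain \<phi> where \<phi>: "\<phi> \<in> algebra_iso B (mat_algebra (d + 1))"
    using B by (auto simp: is_mat_algebra_def)
  have orth: "orth_rank1_idempotents d A E" "orth_rank1_idempotents d A Es"
    using sys by (simp_all add: idempotent_system_def)
  have carrier: "E i \<in> carrier A" "Es i \<in> carrier A" if "i \<le> d" for i
    using orth that by (simp_all add: orth_rank1_idempotents_def)
  have transport: "orth_rank1_idempotents d B G"
    if G: "orth_rank1_idempotents d A G'" "\<And>i. i \<le> d \<Longrightarrow> \<chi> (G' i) = G i" for G G'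
  proof -
    obtain P where P: "P \<in> carrier_mat (d + 1) (d + 1)" "invertible_mat P"
      and G': "\<And>i. i \<le> d \<Longrightarrow> G' i \<in> carrier A \<and> \<phi> (\<chi> (G' i)) = P * Delta d i i * mat_inv P"
      using G(1)[unfolded orth_rank1_idempotents_iff[OF A algebra_iso_comp[OF \<chi>(1) \<phi>]]] by auto
    have "G i \<in> carrier B \<and> \<phi> (G i) = P * Delta d i i * mat_inv P" if "i \<le> d" for i
      using G'[OF that] G(2)[OF that] algebra_isoD(4)[OF \<chi>(1), of "G' i"] by simp
    with P show ?thesis
      unfolding orth_rank1_idempotents_iff[OF B' \<phi>] by blast
  qed
  have nonzero: "\<chi> x \<otimes>\<^bsub>B\<^esub> \<chi> y \<otimes>\<^bsub>B\<^esub> \<chi> x \<noteq> \<zero>\<^bsub>B\<^esub>"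
    if "x \<in> carrier A" "y \<in> carrier A" "x \<otimes>\<^bsub>A\<^esub> y \<otimes>\<^bsub>A\<^esub> x \<noteq> \<zero>\<^bsub>A\<^esub>" for x y
  proof -
    have "\<chi> (x \<otimes>\<^bsub>A\<^esub> y \<otimes>\<^bsub>A\<^esub> x) \<noteq> \<chi> \<zero>\<^bsub>A\<^esub>"
      using that algebra_isoD(3)[OF \<chi>(1)] by (auto dest: inj_onD)
    then show ?thesis
      using that algebra_isoD(5)[OF \<chi>(1)] algebra_iso_zero[OF A B' \<chi>(1)] by simp
  qed
  have "F 0 \<otimes>\<^bsub>B\<^esub> Fs i \<otimes>\<^bsub>B\<^esub> F 0 \<noteq> \<zero>\<^bsub>B\<^esub> \<and> Fs 0 \<otimes>\<^bsub>B\<^esub> F i \<otimes>\<^bsub>B\<^esub> Fs 0 \<noteq> \<zero>\<^bsub>B\<^esub>"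
    if "i \<le> d" for i
    using nonzero[of "E 0" "Es i"] nonzero[of "Es 0" "E i"] that sys carrier \<chi>(2)[of 0] \<chi>(2)[of i]
    by (simp add: idempotent_system_def)
  moreover have "orth_rank1_idempotents d B F" "orth_rank1_idempotents d B Fs"
    using transport[OF orth(1)] transport[OF orth(2)] \<chi>(2) by blast+
  ultimately show ?thesis
    using B by (simp add: idempotent_system_def)
qed

lemma antiautomorphism_transport:
  fixes A :: "('f::field, 'a) module" and B :: "('f, 'b) module"
  assumes A: "assoc_algebra A" and \<chi>: "\<chi> \<in> algebra_iso A B" and \<tau>: "antiautomorphism A \<tau>"
  shows "antiautomorphism B (\<chi> \<circ> \<tau> \<circ> inv_into (carrier A) \<chi>)"
proof -
  note inv = algebra_iso_inv[OF A \<chi>]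
  have "bij_betw \<tau> (carrier A) (carrier A)"
    using \<tau> by (simp add: antiautomorphism_def)
  then have "bij_betw (\<chi> \<circ> \<tau> \<circ> inv_into (carrier A) \<chi>) (carrier B) (carrier B)"
    using bij_betw_trans[OF algebra_isoD(2)[OF inv] bij_betw_trans[OF _ algebra_isoD(2)[OF \<chi>]]]
    by (simp add: comp_assoc)
  moreover have "\<tau> x \<in> carrier A" if "x \<in> carrier A" for x
    using \<tau> that by (auto simp: antiautomorphism_def dest: bij_betwE)
  ultimately show ?thesis
    using \<tau> unfolding antiautomorphism_def
    by (simp add: algebra_isoD(4-8)[OF \<chi>] algebra_isoD(4-8)[OF inv])
qed

lemma symmetric_idempotent_system_transport:
  fixes A :: "('f::field, 'a) module" and B :: "('f, 'b) module"
  assumes sys: "symmetric_idempotent_system d (A, E, Es)" and B: "is_mat_algebra (d + 1) B"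
    and \<chi>: "\<chi> \<in> algebra_iso A B" "\<And>i. i \<le> d \<Longrightarrow> \<chi> (E i) = F i \<and> \<chi> (Es i) = Fs i"
  shows "symmetric_idempotent_system d (B, F, Fs)"
proof -
  have sys': "idempotent_system d (A, E, Es)"
    using sys by (simp add: symmetric_idempotent_system_def)
  then have A: "assoc_algebra A"
    by (simp add: idempotent_system_def is_mat_algebra_def)
  obtain \<tau> where \<tau>: "antiautomorphism A \<tau>" "\<And>i. i \<le> d \<Longrightarrow> \<tau> (E i) = E i \<and> \<tau> (Es i) = Es i"
    using sys by (auto simp: symmetric_idempotent_system_def)
  \<comment> \<open>The antiautomorphism of \<open>A\<close> conjugated by \<open>\<chi>\<close>; it
    fixes the images of the idempotents that \<open>\<tau>\<close> fixes.\<close>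
  let ?\<sigma> = "\<chi> \<circ> \<tau> \<circ> inv_into (carrier A) \<chi>"
  have "inv_into (carrier A) \<chi> (F i) = E i \<and> inv_into (carrier A) \<chi> (Fs i) = Es i" if "i \<le> d" for i
  proof -
    have "E i \<in> carrier A" "Es i \<in> carrier A"
      using sys' that by (simp_all add: idempotent_system_def orth_rank1_idempotents_def)
    then show ?thesis
      using \<chi>(2)[OF that] inv_into_f_f[OF algebra_isoD(3)[OF \<chi>(1)], of "E i"]
        inv_into_f_f[OF algebra_isoD(3)[OF \<chi>(1)], of "Es i"] by simp
  qed
  then have "?\<sigma> (F i) = F i \<and> ?\<sigma> (Fs i) = Fs i" if "i \<le> d" for i
    using that \<tau>(2) \<chi>(2) by simp
  then show ?thesis
    using antiautomorphism_transport[OF A \<chi>(1) \<tau>(1)] idempotent_system_transport[OF sys' B \<chi>]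
    unfolding symmetric_idempotent_system_def by blast
qed

section \<open>Isomorphism as an equivalence between idempotent systems\<close>

lemma idem_sys_isomorphic_refl: "idem_sys_isomorphic d \<Phi> \<Phi>"
  using id_algebra_iso by (cases \<Phi>) (auto simp: idem_sys_isomorphic_def intro!: bexI[of _ id])

lemma idem_sys_isomorphic_sym:
  assumes sys: "idempotent_system d \<Phi>" and iso: "idem_sys_isomorphic d \<Phi> \<Psi>"
  shows "idem_sys_isomorphic d \<Psi> \<Phi>"
proof -
  obtain A E Es B F Fs where eqs: "\<Phi> = (A, E, Es)" "\<Psi> = (B, F, Fs)"
    by (metis prod_cases3)
  obtain \<phi> where \<phi>: "\<phi> \<in> algebra_iso A B" "\<And>i. i \<le> d \<Longrightarrow> \<phi> (E i) = F i \<and> \<phi> (Es i) = Fs i"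
    using iso by (auto simp: eqs idem_sys_isomorphic_def)
  have A: "assoc_algebra A"
    using sys by (simp add: eqs idempotent_system_def is_mat_algebra_def)
  have "inv_into (carrier A) \<phi> (F i) = E i \<and> inv_into (carrier A) \<phi> (Fs i) = Es i"
    if "i \<le> d" for i
  proof -
    \<comment> \<open>\<open>inv_into\<close> inverts \<open>\<phi>\<close> only on the carrier, and
      the system property places the idempotents there.\<close>
    have "E i \<in> carrier A" "Es i \<in> carrier A"
      using sys that by (simp_all add: eqs idempotent_system_def orth_rank1_idempotents_def)
    then show ?thesis
      using \<phi>(2)[OF that] inv_into_f_f[OF algebra_isoD(3)[OF \<phi>(1)], of "E i"]
        inv_into_f_f[OF algebra_isoD(3)[OF \<phi>(1)], of "Es i"] by simp
  qed
  then show ?thesis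
    using algebra_iso_inv[OF A \<phi>(1)] by (auto simp: eqs idem_sys_isomorphic_def)
qed

lemma idem_sys_isomorphic_trans:
  assumes "idem_sys_isomorphic d \<Phi> \<Psi>" "idem_sys_isomorphic d \<Psi> \<Omega>"
  shows "idem_sys_isomorphic d \<Phi> \<Omega>"
proof -
  obtain A E Es B F Fs C G Gs where eqs: "\<Phi> = (A, E, Es)" "\<Psi> = (B, F, Fs)" "\<Omega> = (C, G, Gs)"
    by (metis prod_cases3)
  obtain \<phi> \<psi> where "\<phi> \<in> algebra_iso A B" "\<forall>i\<le>d. \<phi> (E i) = F i \<and> \<phi> (Es i) = Fs i"
    and "\<psi> \<in> algebra_iso B C" "\<forall>i\<le>d. \<psi> (F i) = G i \<and> \<psi> (Fs i) = Gs i"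
    using assms by (auto simp: eqs idem_sys_isomorphic_def)
  then show ?thesis
    using algebra_iso_comp[of \<phi> A B \<psi> C]
    unfolding eqs idem_sys_isomorphic_def prod.case by (intro bexI[of _ "\<psi> \<circ> \<phi>"]) auto
qed

section \<open>Diagonal equivalence\<close>

text \<open>Multiplying by \<open>mat_inv V\<close> from the left and by \<open>U\<close> from the
  right turns each equation into commutation of \<open>mat_inv V * U\<close> with
  \<open>Delta d i i\<close>, which characterizes diagonal matrices. Both criteria below, for
  isomorphism and for symmetry, rest on it.\<close>

lemma conj_Delta_eq_iff:
  fixes U V :: "'f::field mat"
  assumes U: "U \<in> carrier_mat (d + 1) (d + 1)" "invertible_mat U"
    and V: "V \<in> carrier_mat (d + 1) (d + 1)" "invertible_mat V"
  shows "(\<forall>i\<le>d. U * Delta d i i * mat_inv U = V * Delta d i i * mat_inv V)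
    \<longleftrightarrow> diagonal_mat (mat_inv V * U)"
proof -
  note U' = mat_inv[OF U] and V' = mat_inv[OF V]
  note simps = square_mat_simps[where n = "Suc d"]
  have "U * Delta d i i * mat_inv U = V * Delta d i i * mat_inv V
    \<longleftrightarrow> mat_inv V * U * Delta d i i = Delta d i i * (mat_inv V * U)" for i
  proof
    assume "U * Delta d i i * mat_inv U = V * Delta d i i * mat_inv V"
    then have "mat_inv V * (U * Delta d i i * mat_inv U) * U = mat_inv V * (V * Delta d i i * mat_inv V) * U"
      by simp
    then show "mat_inv V * U * Delta d i i = Delta d i i * (mat_inv V * U)"
      using U V U' V' by (simp add: simps)
  next
    assume "mat_inv V * U * Delta d i i = Delta d i i * (mat_inv V * U)"
    then have "V * (mat_inv V * U * Delta d i i) * mat_inv U = V * (Delta d i i * (mat_inv V * U)) * mat_inv U"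
      by simp
    then show "U * Delta d i i * mat_inv U = V * Delta d i i * mat_inv V"
      using U V U' V' by (simp add: simps)
  qed
  then show ?thesis
    using U V' by (subst diagonal_mat_iff_commutes_Delta[of _ d]) (auto simp: simps)
qed

text \<open>The preceding criterion with the identity as \<open>V\<close>; it identifies the inner
  automorphisms that fix the first sequence of \<open>Phi d R\<close>.\<close>

lemma diagonal_mat_iff_fixes_Delta:
  assumes "(D :: 'f::field mat) \<in> carrier_mat (d + 1) (d + 1)" "invertible_mat D"
  shows "diagonal_mat D \<longleftrightarrow> (\<forall>i\<le>d. D * Delta d i i * mat_inv D = Delta d i i)"
proof -
  have one: "invertible_mat (1\<^sub>m (d + 1) :: 'f mat)" "mat_inv (1\<^sub>m (d + 1) :: 'f mat) = 1\<^sub>m (d + 1)"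
    using mat_inv_unique[of "1\<^sub>m (d + 1) :: 'f mat" "d + 1" "1\<^sub>m (d + 1)"] by simp_all
  show ?thesis
    using conj_Delta_eq_iff[OF assms one_carrier_mat one(1)] one(2) assms(1) by simp
qed

text \<open>If conjugation by \<open>D\<close> fixes the diagonal units, then so does conjugation by
  its inverse.\<close>

lemma diagonal_mat_inv:
  assumes D: "(D :: 'f::field mat) \<in> carrier_mat (d + 1) (d + 1)" "invertible_mat D"
    and "diagonal_mat D"
  shows "diagonal_mat (mat_inv D)"
proof -
  note D' = mat_inv[OF D]
  have "mat_inv D * Delta d i i * mat_inv (mat_inv D) = Delta d i i" if "i \<le> d" for i
  proof -
    have "mat_inv D * (D * Delta d i i * mat_inv D) * D = mat_inv D * Delta d i i * D"
      using assms that diagonal_mat_iff_fixes_Delta[OF D] by simp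
    then show ?thesis
      using D D' invertible_mat_inv[OF D] by (simp add: square_mat_simps[where n = "Suc d"])
  qed
  then show ?thesis
    using diagonal_mat_iff_fixes_Delta[OF D'(1)] invertible_mat_inv[OF D] by blast
qed

lemma diagonal_mat_mult:
  assumes "(D :: 'f::field mat) \<in> carrier_mat (d + 1) (d + 1)" "diagonal_mat D"
    and "D' \<in> carrier_mat (d + 1) (d + 1)" "diagonal_mat D'"
  shows "diagonal_mat (D * D')"
proof -
  have "D * D' * Delta d i i = Delta d i i * (D * D')" if "i \<le> d" for i
  proof -
    have "D * Delta d i i = Delta d i i * D" "D' * Delta d i i = Delta d i i * D'"
      using assms diagonal_mat_iff_commutes_Delta that by blast+
    then show ?thesis
      using assoc_mult_mat[OF assms(1,3) Delta_carrier] assoc_mult_mat[OF assms(1) Delta_carrier assms(3)]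
        assoc_mult_mat[OF Delta_carrier assms(1,3)] by metis
  qed
  then show ?thesis
    using assms diagonal_mat_iff_commutes_Delta[of "D * D'" d] by simp
qed

lemma diag_equivI:
  assumes "S \<in> carrier_mat (d + 1) (d + 1)" "T = H * S * K"
    and "H \<in> carrier_mat (d + 1) (d + 1)" "invertible_mat H" "diagonal_mat H"
    and "K \<in> carrier_mat (d + 1) (d + 1)" "invertible_mat K" "diagonal_mat K"
  shows "(S, T) \<in> diag_equiv d"
  using assms unfolding diag_equiv_def by fastforce

lemma equiv_diag_equiv: "equiv (carrier_mat (d + 1) (d + 1)) (diag_equiv d :: 'f::field mat rel)"
proof (rule equivI)
  let ?M = "carrier_mat (d + 1) (d + 1) :: 'f mat set"
  show "diag_equiv d \<subseteq> ?M \<times> ?M"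
    by (auto simp: diag_equiv_def)
  have one: "invertible_mat (1\<^sub>m (d + 1) :: 'f mat)" "diagonal_mat (1\<^sub>m (d + 1) :: 'f mat)"
    using mat_inv_unique[of "1\<^sub>m (d + 1) :: 'f mat" "d + 1" "1\<^sub>m (d + 1)"]
    by (auto simp: diagonal_mat_def)
  show "refl_on ?M (diag_equiv d)"
  proof (rule refl_onI)
    fix S :: "'f mat" assume "S \<in> ?M"
    then show "(S, S) \<in> diag_equiv d"
      using one by (intro diag_equivI[of _ _ _ "1\<^sub>m (d + 1)" "1\<^sub>m (d + 1)"]) auto
  qed
  show "sym (diag_equiv d :: 'f mat rel)"
  proof (rule symI)
    fix S T :: "'f mat" assume "(S, T) \<in> diag_equiv d"
    then obtain H K where S: "S \<in> ?M" and H: "H \<in> ?M" "invertible_mat H" "diagonal_mat H"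
      and K: "K \<in> ?M" "invertible_mat K" "diagonal_mat K" and T: "T = H * S * K"
      by (auto simp: diag_equiv_def)
    have "S = mat_inv H * T * mat_inv K"
      using S H K mat_inv[OF H(1,2)] mat_inv[OF K(1,2)]
      by (simp add: T square_mat_simps[where n = "Suc d"])
    then show "(T, S) \<in> diag_equiv d"
      using S H K T mat_inv[OF H(1,2)] mat_inv[OF K(1,2)] invertible_mat_inv[OF H(1,2)]
        invertible_mat_inv[OF K(1,2)] diagonal_mat_inv[OF H] diagonal_mat_inv[OF K]
      by (intro diag_equivI[of _ _ _ "mat_inv H" "mat_inv K"]) auto
  qed
  show "trans (diag_equiv d :: 'f mat rel)"
  proof (rule transI)
    fix S T U :: "'f mat" assume "(S, T) \<in> diag_equiv d" "(T, U) \<in> diag_equiv d"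
    then obtain H K H' K' where S: "S \<in> ?M" and H: "H \<in> ?M" "invertible_mat H" "diagonal_mat H"
      and K: "K \<in> ?M" "invertible_mat K" "diagonal_mat K" and T: "T = H * S * K"
      and H': "H' \<in> ?M" "invertible_mat H'" "diagonal_mat H'"
      and K': "K' \<in> ?M" "invertible_mat K'" "diagonal_mat K'" and U: "U = H' * T * K'"
      unfolding diag_equiv_def by blast
    have "U = (H' * H) * S * (K * K')"
      using S H K H' K' by (simp add: T U square_mat_simps[where n = "Suc d"])
    then show "(S, U) \<in> diag_equiv d"
      using S U T H K H' K' invertible_mult[OF H'(1,2) H(1,2)] invertible_mult[OF K(1,2) K'(1,2)]
        diagonal_mat_mult[OF H'(1,3) H(1,3)] diagonal_mat_mult[OF K(1,3) K'(1,3)]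
      by (intro diag_equivI[of _ _ _ "H' * H" "K * K'"]) auto
  qed
qed

section \<open>The systems attached to matrices\<close>

lemma transpose_Delta: "transpose_mat (Delta d i j) = Delta d j i"
  by (auto simp: Delta_def)

lemma transpose_conj_Delta:
  assumes "(R :: 'f::field mat) \<in> carrier_mat (d + 1) (d + 1)" "Q \<in> carrier_mat (d + 1) (d + 1)"
  shows "transpose_mat (R * Delta d i i * Q) = transpose_mat Q * Delta d i i * transpose_mat R"
proof -
  have "transpose_mat (R * Delta d i i * Q) = transpose_mat Q * transpose_mat (R * Delta d i i)"
    using assms by (intro transpose_mult) (auto simp: square_mat_simps[where n = "Suc d"])
  also have "transpose_mat (R * Delta d i i) = Delta d i i * transpose_mat R"
    using transpose_mult[OF assms(1) Delta_carrier] by (simp add: transpose_Delta)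
  finally show ?thesis
    using assms by (simp add: square_mat_simps[where n = "Suc d"])
qed

lemma transpose_smult: "transpose_mat (c \<cdot>\<^sub>m A) = c \<cdot>\<^sub>m transpose_mat A"
  by (intro eq_matI) auto

lemma smult_mat_eq_zero_iff:
  assumes "(A :: 'f::field mat) \<in> carrier_mat n m"
  shows "c \<cdot>\<^sub>m A = 0\<^sub>m n m \<longleftrightarrow> c = 0 \<or> A = 0\<^sub>m n m"
proof
  assume *: "c \<cdot>\<^sub>m A = 0\<^sub>m n m"
  have "A = 0\<^sub>m n m" if "c \<noteq> 0"
  proof (rule eq_matI)
    fix i j assume "i < dim_row (0\<^sub>m n m :: 'f mat)" "j < dim_col (0\<^sub>m n m :: 'f mat)"
    then show "A $$ (i, j) = 0\<^sub>m n m $$ (i, j)"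
      using arg_cong[OF *, of "\<lambda>M. M $$ (i, j)"] assms that by simp
  qed (use assms in auto)
  then show "c = 0 \<or> A = 0\<^sub>m n m" by blast
qed (use assms in \<open>auto intro!: eq_matI\<close>)

lemma conj_Delta_neq_zero:
  assumes "(R :: 'f::field mat) \<in> carrier_mat (d + 1) (d + 1)" "invertible_mat R" "i \<le> d"
  shows "R * Delta d i i * mat_inv R \<noteq> 0\<^sub>m (d + 1) (d + 1)"
  using rank_conj_Delta[OF assms] by (auto simp: vec_space.rank_0I)

text \<open>Up to a nonzero idempotent, the triple products are the scalars
  \<open>R $$ (0, i) * mat_inv R $$ (i, 0)\<close> and
  \<open>mat_inv R $$ (0, i) * R $$ (i, 0)\<close>. The rank and orthogonality conditions hold for
  every invertible \<open>R\<close>.\<close>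

lemma idempotent_system_Phi_iff:
  fixes R :: "'f::field mat"
  assumes R: "R \<in> carrier_mat (d + 1) (d + 1)" "invertible_mat R"
  shows "idempotent_system d (Phi d R) \<longleftrightarrow> solid_invertible d R"
proof -
  note Q = mat_inv[OF R]
  note simps = square_mat_simps[where n = "Suc d"]
  let ?Es = "\<lambda>i. R * Delta d i i * mat_inv R"
  have Es: "?Es i \<in> carrier_mat (d + 1) (d + 1)" for i
    using R Q by (simp add: simps)
  have one: "invertible_mat (1\<^sub>m (d + 1) :: 'f mat)" "mat_inv (1\<^sub>m (d + 1) :: 'f mat) = 1\<^sub>m (d + 1)"
    using mat_inv_unique[of "1\<^sub>m (d + 1) :: 'f mat" "d + 1" "1\<^sub>m (d + 1)"] by simp_all
  note iff = orth_rank1_idempotents_iff[OF assoc_algebra_mat id_algebra_iso]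
  have "orth_rank1_idempotents d (mat_algebra (d + 1)) (\<lambda>i. Delta d i i :: 'f mat)"
    unfolding iff using one by (intro bexI[of _ "1\<^sub>m (d + 1)"]) (auto simp: simps)
  moreover have "orth_rank1_idempotents d (mat_algebra (d + 1)) ?Es"
    unfolding iff using R Es by (intro bexI[of _ R]) auto
  moreover have "Delta d 0 0 * ?Es i * Delta d 0 0 \<noteq> 0\<^sub>m (d + 1) (d + 1)
      \<longleftrightarrow> R $$ (0, i) \<noteq> 0 \<and> mat_inv R $$ (i, 0) \<noteq> 0" if "i \<le> d" for i
    using Delta_sandwich[OF Es, of 0 0] index_mult_Delta_mult[OF R(1) Q(1) that that, of 0 0]
      Delta_neq_zero[of 0 d 0, where ?'f = 'f] smult_mat_eq_zero_iff[OF Delta_carrier, of "R $$ (0, i) * mat_inv R $$ (i, 0)" d 0 0]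
    by (simp del: index_mult_mat)
  moreover have "?Es 0 * Delta d i i * ?Es 0 \<noteq> 0\<^sub>m (d + 1) (d + 1)
      \<longleftrightarrow> R $$ (i, 0) \<noteq> 0 \<and> mat_inv R $$ (0, i) \<noteq> 0" if "i \<le> d" for i
  proof -
    \<comment> \<open>Moving the conjugation by \<open>R\<close> outside leaves a sandwich of
      \<open>?W\<close> between two copies of \<open>Delta d 0 0\<close>.\<close>
    let ?W = "mat_inv R * Delta d i i * R"
    have W: "?W \<in> carrier_mat (d + 1) (d + 1)"
      using R Q by (simp add: simps)
    have "?Es 0 * Delta d i i * ?Es 0 = R * (Delta d 0 0 * ?W * Delta d 0 0) * mat_inv R"
      using R Q by (simp add: simps)
    also have "Delta d 0 0 * ?W * Delta d 0 0 = ?W $$ (0, 0) \<cdot>\<^sub>m Delta d 0 0"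
      by (rule Delta_sandwich[OF W]) auto
    also have "R * (c \<cdot>\<^sub>m Delta d 0 0) * mat_inv R = c \<cdot>\<^sub>m ?Es 0" for c
      using R Q by (simp add: mult_smult_distrib[of _ "Suc d" "Suc d" _ "Suc d"]
          mult_smult_assoc_mat[of _ "Suc d" "Suc d" _ "Suc d"] simps)
    also have "?W $$ (0, 0) = mat_inv R $$ (0, i) * R $$ (i, 0)"
      using index_mult_Delta_mult[OF Q(1) R(1) that that, of 0 0] by simp
    finally show ?thesis
      using conj_Delta_neq_zero[OF R, of 0] smult_mat_eq_zero_iff[OF Es] by auto
  qed
  ultimately show ?thesis
    using R is_mat_algebra_mat
    by (auto simp: idempotent_system_def Phi_def solid_invertible_def simp del: index_mult_mat One_nat_def add_Suc_right)
qed

text \<open>After the algebra is identified with matrices, the two sequences are diagonalized by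
  \<open>P\<close> and \<open>Q\<close>. Conjugating back by \<open>P\<close> turns the first into
  the diagonal units and leaves \<open>mat_inv P * Q\<close> to diagonalize the second.\<close>

lemma idem_sys_isomorphic_Phi:
  fixes A :: "('f::field, 'a) module"
  assumes sys: "idempotent_system d (A, E, Es)"
  obtains R where "R \<in> carrier_mat (d + 1) (d + 1)" "invertible_mat R"
    "idem_sys_isomorphic d (A, E, Es) (Phi d R)"
proof -
  have A: "assoc_algebra A"
    using sys by (simp add: idempotent_system_def is_mat_algebra_def)
  obtain \<phi> where \<phi>: "\<phi> \<in> algebra_iso A (mat_algebra (d + 1))"
    using sys by (auto simp: idempotent_system_def is_mat_algebra_def)
  have orth: "orth_rank1_idempotents d A E" "orth_rank1_idempotents d A Es"
    using sys by (simp_all add: idempotent_system_def)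
  obtain P where P: "P \<in> carrier_mat (d + 1) (d + 1)" "invertible_mat P"
    and E: "\<And>i. i \<le> d \<Longrightarrow> \<phi> (E i) = P * Delta d i i * mat_inv P"
    using orth(1) unfolding orth_rank1_idempotents_iff[OF A \<phi>] by blast
  obtain Q where Q: "Q \<in> carrier_mat (d + 1) (d + 1)" "invertible_mat Q"
    and Es: "\<And>i. i \<le> d \<Longrightarrow> \<phi> (Es i) = Q * Delta d i i * mat_inv Q"
    using orth(2) unfolding orth_rank1_idempotents_iff[OF A \<phi>] by blast
  note P' = mat_inv[OF P] invertible_mat_inv[OF P] and Q' = mat_inv[OF Q]
  note simps = square_mat_simps[where n = "Suc d"]
  let ?R = "mat_inv P * Q"
  let ?\<chi> = "(\<lambda>Y. mat_inv P * Y * mat_inv (mat_inv P)) \<circ> \<phi>"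
  have "?\<chi> \<in> algebra_iso A (mat_algebra (d + 1))"
    using algebra_iso_comp[OF \<phi> conj_algebra_iso[OF P'(1,4)]] .
  moreover have "?\<chi> (E i) = Delta d i i \<and> ?\<chi> (Es i) = ?R * Delta d i i * mat_inv ?R" if "i \<le> d" for i
    using P Q P' Q' by (simp add: E[OF that] Es[OF that] invertible_mult[OF P'(1,4) Q] simps)
  ultimately have "idem_sys_isomorphic d (A, E, Es) (Phi d ?R)"
    unfolding idem_sys_isomorphic_def Phi_def prod.case by blast
  then show thesis
    using that[of ?R] invertible_mult[OF P'(1,4) Q] P' Q by simp
qed

lemma idem_sys_isomorphic_Phi_iff:
  fixes R S :: "'f::field mat"
  assumes R: "R \<in> carrier_mat (d + 1) (d + 1)" "invertible_mat R"
    and S: "S \<in> carrier_mat (d + 1) (d + 1)" "invertible_mat S"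
  shows "idem_sys_isomorphic d (Phi d R) (Phi d S) \<longleftrightarrow> (R, S) \<in> diag_equiv d"
proof -
  note R' = mat_inv[OF R] and S' = mat_inv[OF S]
  note simps = square_mat_simps[where n = "Suc d"]
  \<comment> \<open>Splits the requirement on a conjugation: fixing the diagonal units makes
    \<open>P\<close> diagonal, and matching the second sequences compares the eigenbases
    \<open>P * R\<close> and \<open>S\<close>.\<close>
  have conj: "(\<forall>i\<le>d. P * Delta d i i * mat_inv P = Delta d i i \<and>
        P * (R * Delta d i i * mat_inv R) * mat_inv P = S * Delta d i i * mat_inv S)
      \<longleftrightarrow> diagonal_mat P \<and> diagonal_mat (mat_inv S * (P * R))"
    if P: "P \<in> carrier_mat (d + 1) (d + 1)" "invertible_mat P" for P
  proof -
    have PR: "P * R \<in> carrier_mat (d + 1) (d + 1)" "invertible_mat (P * R)"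
      and PR': "mat_inv (P * R) = mat_inv R * mat_inv P"
      using invertible_mult[OF P R] P R by auto
    have "P * (R * Delta d i i * mat_inv R) * mat_inv P = P * R * Delta d i i * mat_inv (P * R)" for i
      using P R R' mat_inv[OF P] by (simp add: PR' simps)
    then show ?thesis
      using conj_Delta_eq_iff[OF PR S] diagonal_mat_iff_fixes_Delta[OF P] by auto
  qed
  show ?thesis
  proof
    assume "idem_sys_isomorphic d (Phi d R) (Phi d S)"
    then obtain \<phi> where \<phi>: "\<phi> \<in> algebra_iso (mat_algebra (d + 1)) (mat_algebra (d + 1))"
      and fixed: "\<And>i. i \<le> d \<Longrightarrow> \<phi> (Delta d i i) = Delta d i i"
        "\<And>i. i \<le> d \<Longrightarrow> \<phi> (R * Delta d i i * mat_inv R) = S * Delta d i i * mat_inv S"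
      unfolding idem_sys_isomorphic_def Phi_def prod.case by blast
    obtain P where P: "P \<in> carrier_mat (d + 1) (d + 1)" "invertible_mat P"
      and inner: "\<And>Y. Y \<in> carrier_mat (d + 1) (d + 1) \<Longrightarrow> \<phi> Y = P * Y * mat_inv P"
      by (rule algebra_iso_mat_inner[OF \<phi>], rule that)
    have carrier: "R * Delta d i i * mat_inv R \<in> carrier_mat (d + 1) (d + 1)" for i
      using R R' by (simp add: simps)
    have "\<forall>i\<le>d. P * Delta d i i * mat_inv P = Delta d i i \<and>
        P * (R * Delta d i i * mat_inv R) * mat_inv P = S * Delta d i i * mat_inv S"
      using fixed[unfolded inner[OF Delta_carrier] inner[OF carrier]] by blast
    then have diag: "diagonal_mat P" "diagonal_mat (mat_inv S * (P * R))"
      using conj[OF P] by blast+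
    \<comment> \<open>Here \<open>S * K = P * R\<close>, so the diagonal equivalence has
      \<open>P\<close> on the left and the inverse of \<open>K\<close> on the right.\<close>
    define K where "K = mat_inv S * (P * R)"
    have K: "K \<in> carrier_mat (d + 1) (d + 1)" "invertible_mat K"
      and K': "mat_inv K = mat_inv R * mat_inv P * S"
      using invertible_mult[OF P R] invertible_mat_inv[OF S] P R S S'
        invertible_mult[of "mat_inv S" "d + 1" "P * R"] by (auto simp: K_def)
    have "S = P * R * mat_inv K"
      using P R S R' S' mat_inv[OF P] by (simp add: K' simps)
    then show "(R, S) \<in> diag_equiv d"
      using R P diag(1) mat_inv[OF K] invertible_mat_inv[OF K] diagonal_mat_inv[OF K diag(2)[folded K_def]]
      by (intro diag_equivI[of _ _ _ P "mat_inv K"]) auto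
  next
    assume "(R, S) \<in> diag_equiv d"
    then obtain H K where H: "H \<in> carrier_mat (d + 1) (d + 1)" "invertible_mat H" "diagonal_mat H"
      and K: "K \<in> carrier_mat (d + 1) (d + 1)" "invertible_mat K" "diagonal_mat K" and eq: "S = H * R * K"
      unfolding diag_equiv_def by blast
    have HR: "H * R \<in> carrier_mat (d + 1) (d + 1)" "invertible_mat (H * R)"
      and HR': "mat_inv (H * R) = mat_inv R * mat_inv H"
      using invertible_mult[OF H(1,2) R] H R by auto
    \<comment> \<open>Conversely, the left factor \<open>H\<close> itself conjugates; the right
      factor appears, inverted, as the comparison matrix.\<close>
    have "mat_inv S * (H * R) = mat_inv K"
      unfolding eq invertible_mult(2)[OF HR K(1,2)] HR'
      using H K R R' mat_inv[OF H(1,2)] mat_inv[OF K(1,2)] by (simp add: simps)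
    then have "diagonal_mat (mat_inv S * (H * R))"
      using diagonal_mat_inv[OF K] by simp
    with conj[OF H(1,2)] H(3) have "\<forall>i\<le>d. H * Delta d i i * mat_inv H = Delta d i i \<and>
        H * (R * Delta d i i * mat_inv R) * mat_inv H = S * Delta d i i * mat_inv S"
      by blast
    then show "idem_sys_isomorphic d (Phi d R) (Phi d S)"
      unfolding idem_sys_isomorphic_def Phi_def prod.case
      by (rule bexI[OF _ conj_algebra_iso[OF H(1,2)]])
  qed
qed

section \<open>Antiautomorphisms of the matrix algebra and symmetric systems\<close>

lemma transpose_conj_antiautomorphism:
  assumes "(P :: 'f::field mat) \<in> carrier_mat n n" "invertible_mat P"
  shows "antiautomorphism (mat_algebra n) (\<lambda>Y. P * transpose_mat Y * mat_inv P)"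
proof -
  note \<phi> = conj_algebra_iso[OF assms]
  have "bij_betw transpose_mat (carrier_mat n n) (carrier_mat n n :: 'f mat set)"
    by (rule bij_betw_byWitness[of _ transpose_mat]) auto
  then have "bij_betw (\<lambda>Y. P * transpose_mat Y * mat_inv P) (carrier_mat n n) (carrier_mat n n)"
    using bij_betw_trans[OF _ algebra_isoD(2)[OF \<phi>]] by (simp add: comp_def)
  then show ?thesis
    using algebra_isoD(5,6,8)[OF \<phi>]
    by (simp add: antiautomorphism_def transpose_add[of _ n n] transpose_mult[of _ n n _ n] transpose_smult)
qed

text \<open>Composed with transposition, \<open>\<tau>\<close> preserves the order of products, so
  the inner form of endomorphisms applies; the fixed unit \<open>Delta d 0 0\<close> excludes the
  zero map.\<close>

lemma antiautomorphism_mat_inner: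
  fixes \<tau> :: "'f::field mat \<Rightarrow> 'f mat"
  assumes \<tau>: "antiautomorphism (mat_algebra (d + 1)) \<tau>" and fixed: "\<tau> (Delta d 0 0) = Delta d 0 0"
  obtains P where "P \<in> carrier_mat (d + 1) (d + 1)" "invertible_mat P"
    "\<And>Y. Y \<in> carrier_mat (d + 1) (d + 1) \<Longrightarrow> \<tau> Y = P * transpose_mat Y * mat_inv P"
proof -
  let ?M = "carrier_mat (d + 1) (d + 1)" and ?\<phi> = "\<lambda>Y. \<tau> (transpose_mat Y)"
  have "\<exists>P\<in>?M. invertible_mat P \<and> (\<forall>Y\<in>?M. ?\<phi> Y = P * Y * mat_inv P)"
  proof (rule mat_endomorphism_inner)
    show "?\<phi> Y \<in> ?M" if "Y \<in> ?M" for Y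
      using \<tau> that unfolding antiautomorphism_def by (auto dest: bij_betwE)
    show "?\<phi> (c \<cdot>\<^sub>m Y) = c \<cdot>\<^sub>m ?\<phi> Y" if "Y \<in> ?M" for c Y
      using \<tau> that by (simp add: antiautomorphism_def transpose_smult)
    show "?\<phi> (Y * Z) = ?\<phi> Y * ?\<phi> Z" if "Y \<in> ?M" "Z \<in> ?M" for Y Z
      using \<tau> that transpose_mult[OF that] by (simp add: antiautomorphism_def)
    show "?\<phi> (Delta d 0 0) \<noteq> 0\<^sub>m (d + 1) (d + 1)"
      using fixed Delta_neq_zero[of 0 d 0] by (simp add: transpose_Delta)
  qed
  then obtain P where P: "P \<in> ?M" "invertible_mat P" "\<forall>Y\<in>?M. ?\<phi> Y = P * Y * mat_inv P"
    by blast
  then have "\<tau> Y = P * transpose_mat Y * mat_inv P" if "Y \<in> ?M" for Y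
    using that P(3)[rule_format, of "transpose_mat Y"] by simp
  then show thesis
    using that P(1,2) by blast
qed

lemma symmetric_Phi_iff:
  fixes R :: "'f::field mat"
  assumes R: "R \<in> carrier_mat (d + 1) (d + 1)" "invertible_mat R"
    and sys: "idempotent_system d (Phi d R)"
  shows "symmetric_idempotent_system d (Phi d R) \<longleftrightarrow> almost_orthogonal d R"
proof -
  note Q = mat_inv[OF R]
  note simps = square_mat_simps[where n = "Suc d"]
  \<comment> \<open>Since \<open>U\<close> inverts \<open>T\<close>, transposing
    \<open>R * Delta d i i * mat_inv R\<close> gives the conjugate of \<open>Delta d i i\<close> by
    \<open>U\<close>.\<close>
  define T U where "T = transpose_mat R" and "U = transpose_mat (mat_inv R)"
  have T: "T \<in> carrier_mat (d + 1) (d + 1)" "invertible_mat T" "mat_inv T = U"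
    using R invertible_transpose[OF R] by (simp_all add: T_def U_def)
  have U: "U \<in> carrier_mat (d + 1) (d + 1)" "invertible_mat U" "mat_inv U = T"
    using mat_inv(1)[OF T(1,2)] invertible_mat_inv[OF T(1,2)] T(3) by simp_all
  note TU = mat_inv[OF T(1,2), unfolded T(3)]
  have conj: "(\<forall>i\<le>d. P * transpose_mat (Delta d i i) * mat_inv P = Delta d i i \<and>
        P * transpose_mat (R * Delta d i i * mat_inv R) * mat_inv P = R * Delta d i i * mat_inv R)
      \<longleftrightarrow> diagonal_mat P \<and> diagonal_mat (mat_inv R * (P * U))"
    if P: "P \<in> carrier_mat (d + 1) (d + 1)" "invertible_mat P" for P
  proof -
    have PU: "P * U \<in> carrier_mat (d + 1) (d + 1)" "invertible_mat (P * U)"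
      and PU': "mat_inv (P * U) = T * mat_inv P"
      using invertible_mult[OF P U(1,2)] P U by auto
    have "P * transpose_mat (R * Delta d i i * mat_inv R) * mat_inv P = P * U * Delta d i i * mat_inv (P * U)" for i
      using P U T mat_inv[OF P] transpose_conj_Delta[OF R(1) Q(1), of i, folded T_def U_def]
      by (simp add: PU' simps)
    then show ?thesis
      using conj_Delta_eq_iff[OF PU R] diagonal_mat_iff_fixes_Delta[OF P] by (auto simp: transpose_Delta)
  qed
  have "symmetric_idempotent_system d (Phi d R) \<longleftrightarrow> (\<exists>P\<in>carrier_mat (d + 1) (d + 1).
      invertible_mat P \<and> diagonal_mat P \<and> diagonal_mat (mat_inv R * (P * U)))" (is "_ = ?ex")
  proof
    assume "symmetric_idempotent_system d (Phi d R)"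
    then obtain \<tau> where \<tau>: "antiautomorphism (mat_algebra (d + 1)) \<tau>"
      and fixed: "\<And>i. i \<le> d \<Longrightarrow> \<tau> (Delta d i i) = Delta d i i"
        "\<And>i. i \<le> d \<Longrightarrow> \<tau> (R * Delta d i i * mat_inv R) = R * Delta d i i * mat_inv R"
      unfolding symmetric_idempotent_system_def Phi_def prod.case by blast
    obtain P where P: "P \<in> carrier_mat (d + 1) (d + 1)" "invertible_mat P"
      and inner: "\<And>Y. Y \<in> carrier_mat (d + 1) (d + 1) \<Longrightarrow> \<tau> Y = P * transpose_mat Y * mat_inv P"
      by (rule antiautomorphism_mat_inner[OF \<tau> fixed(1)[of 0, simplified]], rule that)
    have carrier: "R * Delta d i i * mat_inv R \<in> carrier_mat (d + 1) (d + 1)" for i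
      using R Q by (simp add: simps)
    have "\<forall>i\<le>d. P * transpose_mat (Delta d i i) * mat_inv P = Delta d i i \<and>
        P * transpose_mat (R * Delta d i i * mat_inv R) * mat_inv P = R * Delta d i i * mat_inv R"
      using fixed[unfolded inner[OF Delta_carrier] inner[OF carrier]] by blast
    then have "diagonal_mat P \<and> diagonal_mat (mat_inv R * (P * U))"
      using conj[OF P] by blast
    with P show ?ex by blast
  next
    assume ?ex
    then obtain P where P: "P \<in> carrier_mat (d + 1) (d + 1)" "invertible_mat P"
      and diag: "diagonal_mat P \<and> diagonal_mat (mat_inv R * (P * U))"
      by blast
    show "symmetric_idempotent_system d (Phi d R)"
      unfolding symmetric_idempotent_system_def Phi_def prod.case
      by (rule conjI[OF sys[unfolded Phi_def]], rule exI,
          rule conjI[OF transpose_conj_antiautomorphism[OF P] conj[OF P, THEN iffD2, OF diag]])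
  qed
  also have "\<dots> \<longleftrightarrow> almost_orthogonal d R"
  proof
    assume ?ex
    then obtain P where P: "P \<in> carrier_mat (d + 1) (d + 1)" "invertible_mat P"
      and diag: "diagonal_mat P" "diagonal_mat (mat_inv R * (P * U))"
      by blast
    have "invertible_mat (mat_inv R * (P * U))"
      using invertible_mult[OF P U(1,2)] invertible_mat_inv[OF R] P U Q
        invertible_mult[of "mat_inv R" "d + 1" "P * U"] by auto
    \<comment> \<open>The diagonal matrices become the factors around \<open>T\<close>, because
      \<open>U * T\<close> and \<open>P * mat_inv P\<close> cancel.\<close>
    moreover have "mat_inv R = mat_inv R * (P * U) * T * mat_inv P"
      using P T U Q TU mat_inv[OF P] by (simp add: simps)
    ultimately have "(T, mat_inv R) \<in> diag_equiv d"
      using P U T Q diag mat_inv[OF P] invertible_mat_inv[OF P] diagonal_mat_inv[OF P]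
      by (intro diag_equivI[of _ _ _ "mat_inv R * (P * U)" "mat_inv P"]) auto
    then show "almost_orthogonal d R"
      using R by (simp add: almost_orthogonal_def T_def)
  next
    assume "almost_orthogonal d R"
    then obtain H K where H: "H \<in> carrier_mat (d + 1) (d + 1)" "invertible_mat H" "diagonal_mat H"
      and K: "K \<in> carrier_mat (d + 1) (d + 1)" "invertible_mat K" "diagonal_mat K"
      and eq: "mat_inv R = H * T * K"
      unfolding almost_orthogonal_def diag_equiv_def T_def by blast
    \<comment> \<open>The witness is built from the inverse of the right factor: in
      \<open>H * T * K * (mat_inv K * U)\<close> everything after \<open>H\<close> cancels.\<close>
    have "mat_inv R * (mat_inv K * U) = H"
      unfolding eq using H K T U TU mat_inv[OF K(1,2)] by (simp add: simps)
    then show ?ex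
      using H K mat_inv[OF K(1,2)] invertible_mat_inv[OF K(1,2)] diagonal_mat_inv[OF K]
      by (intro bexI[of _ "mat_inv K"]) auto
  qed
  finally show ?thesis .
qed

section \<open>Matrix representatives and isomorphism classes\<close>

lemma idempotent_system_Phi_transport:
  fixes \<Psi> :: "('f::field, 'a) idem_sys" and R :: "'f mat"
  assumes "idem_sys_isomorphic d \<Psi> (Phi d R)"
  shows "idempotent_system d \<Psi> \<Longrightarrow> idempotent_system d (Phi d R)"
    and "symmetric_idempotent_system d \<Psi> \<Longrightarrow> symmetric_idempotent_system d (Phi d R)"
proof -
  obtain A E Es where \<Psi>: "\<Psi> = (A, E, Es)"
    by (metis prod_cases3)
  obtain \<phi> where \<phi>: "\<phi> \<in> algebra_iso A (mat_algebra (d + 1))"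
    "\<And>i. i \<le> d \<Longrightarrow> \<phi> (E i) = Delta d i i \<and> \<phi> (Es i) = R * Delta d i i * mat_inv R"
    using assms unfolding \<Psi> idem_sys_isomorphic_def Phi_def prod.case by blast
  show "idempotent_system d (Phi d R)" if "idempotent_system d \<Psi>"
    unfolding Phi_def
    by (rule idempotent_system_transport[OF that[unfolded \<Psi>] is_mat_algebra_mat \<phi>])
  show "symmetric_idempotent_system d (Phi d R)" if "symmetric_idempotent_system d \<Psi>"
    unfolding Phi_def
    by (rule symmetric_idempotent_system_transport[OF that[unfolded \<Psi>] is_mat_algebra_mat \<phi>])
qed

lemma symmetric_idempotent_systemD:
  "symmetric_idempotent_system d \<Psi> \<Longrightarrow> idempotent_system d \<Psi>"
  by (auto simp: symmetric_idempotent_system_def)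

text \<open>Both matrix conditions are read off from \<open>Phi d R\<close>: being a system makes
  \<open>R\<close> solid, and symmetry, carried over along the isomorphism, makes it almost
  orthogonal.\<close>

lemma symmetric_idempotent_system_representative:
  fixes \<Psi> :: "('f::field, 'a) idem_sys"
  assumes sym: "symmetric_idempotent_system d \<Psi>"
  obtains R :: "'f mat" where "almost_orthogonal d R" "solid_invertible d R"
    "idem_sys_isomorphic d \<Psi> (Phi d R)"
proof -
  obtain A E Es where \<Psi>: "\<Psi> = (A, E, Es)"
    by (metis prod_cases3)
  obtain R where R: "R \<in> carrier_mat (d + 1) (d + 1)" "invertible_mat R"
    and iso: "idem_sys_isomorphic d \<Psi> (Phi d R)"
    using idem_sys_isomorphic_Phi symmetric_idempotent_systemD[OF sym] unfolding \<Psi> by blast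
  have "idempotent_system d (Phi d R)" "symmetric_idempotent_system d (Phi d R)"
    using idempotent_system_Phi_transport[OF iso] symmetric_idempotent_systemD[OF sym] sym by blast+
  then show thesis
    using that idempotent_system_Phi_iff[OF R] symmetric_Phi_iff[OF R] iso by blast
qed

lemma equiv_idem_sys_iso_rel:
  "equiv {\<Phi>. idempotent_system d \<Phi>} (idem_sys_iso_rel d :: ('f::field, 'a) idem_sys rel)"
proof (rule equivI)
  show "sym (idem_sys_iso_rel d :: ('f, 'a) idem_sys rel)"
    by (rule symI) (auto simp: idem_sys_iso_rel_def intro: idem_sys_isomorphic_sym)
  show "trans (idem_sys_iso_rel d :: ('f, 'a) idem_sys rel)"
    by (rule transI) (auto simp: idem_sys_iso_rel_def intro: idem_sys_isomorphic_trans)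
qed (auto simp: idem_sys_iso_rel_def idem_sys_isomorphic_refl refl_on_def)

lemma diag_equiv_invertible:
  assumes "(R, S) \<in> diag_equiv d" "invertible_mat R"
  shows "S \<in> carrier_mat (d + 1) (d + 1)" "invertible_mat S"
proof -
  obtain H K where R: "R \<in> carrier_mat (d + 1) (d + 1)"
    and S: "S \<in> carrier_mat (d + 1) (d + 1)" "S = H * R * K"
    and H: "H \<in> carrier_mat (d + 1) (d + 1)" "invertible_mat H"
    and K: "K \<in> carrier_mat (d + 1) (d + 1)" "invertible_mat K"
    using assms unfolding diag_equiv_def by blast
  show "S \<in> carrier_mat (d + 1) (d + 1)"
    by (rule S(1))
  have "H * R \<in> carrier_mat (d + 1) (d + 1)"
    using H R by simp
  then show "invertible_mat S"
    unfolding S(2) using invertible_mult(1)[OF _ invertible_mult(1)[OF H R assms(2)] K] by blast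
qed

text \<open>The description in \<open>Phi_class\<close> is unambiguous. Equivalent matrices have
  isomorphic systems, so the class of \<open>Phi d R\<close> qualifies; any other candidate contains
  \<open>Phi d R\<close> as well and is therefore the same class.\<close>

lemma Phi_class_eq:
  fixes R :: "'f::field mat"
  assumes "solid_invertible d R"
  shows "Phi_class d (diag_equiv d `` {R}) = idem_sys_iso_rel d `` {Phi d R}"
proof -
  have R: "R \<in> carrier_mat (d + 1) (d + 1)" "invertible_mat R"
    using assms by (auto simp: solid_invertible_def)
  have sys: "idempotent_system d (Phi d R)"
    using idempotent_system_Phi_iff[OF R] assms by simp
  let ?C = "idem_sys_iso_rel d `` {Phi d R}"
  have "Phi d S \<in> ?C" if "(R, S) \<in> diag_equiv d" for S
  proof -
    have "idem_sys_isomorphic d (Phi d R) (Phi d S)"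
      using idem_sys_isomorphic_Phi_iff[OF R diag_equiv_invertible[OF that R(2)]] that by simp
    then show ?thesis
      using idempotent_system_Phi_transport(1)[OF _ sys] sys by (simp add: idem_sys_iso_rel_def)
  qed
  then have C: "?C \<in> idem_sys_classes d \<and> (\<forall>S\<in>diag_equiv d `` {R}. Phi d S \<in> ?C)"
    using sys by (auto simp: idem_sys_classes_def intro: quotientI)
  have RR: "R \<in> diag_equiv d `` {R}"
    using equiv_class_self[OF equiv_diag_equiv R(1)] .
  have unique: "D = ?C"
    if D: "D \<in> idem_sys_classes d \<and> (\<forall>S\<in>diag_equiv d `` {R}. Phi d S \<in> D)" for D
  proof -
    obtain \<Psi> where "D = idem_sys_iso_rel d `` {\<Psi>}"
      using D unfolding idem_sys_classes_def by (blast elim: quotientE)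
    moreover from this have "(\<Psi>, Phi d R) \<in> idem_sys_iso_rel d"
      using D RR by blast
    ultimately show ?thesis
      using equiv_class_eq[OF equiv_idem_sys_iso_rel] by blast
  qed
  show ?thesis
    unfolding Phi_class_def by (rule the_equality, rule C, rule unique)
qed

text \<open>Isomorphism classes are formed in the single carrier type \<open>'f mat\<close>. The
  second conjunct shows that nothing is lost by this: it places symmetric systems over an arbitrary
  carrier type \<open>'a\<close> among the same classes.\<close>

theorem theorem5p6:
  fixes d :: nat
  shows "bij_betw (Phi_class d)
           (AO_solid_classes d :: 'f::field mat set set)
           (symmetric_idem_sys_classes d :: ('f, 'f mat) idem_sys set set)
         \<and> (\<forall>\<Psi> :: ('f, 'a) idem_sys. symmetric_idempotent_system d \<Psi> \<longrightarrow>
              (\<exists>!C. C \<in> (symmetric_idem_sys_classes d :: ('f, 'f mat) idem_sys set set) \<and>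
                    (\<forall>\<Phi>\<in>C. idem_sys_isomorphic d \<Psi> \<Phi>)))"
proof -
  let ?AO = "{R :: 'f mat. almost_orthogonal d R \<and> solid_invertible d R}"
  let ?r = "idem_sys_iso_rel d :: ('f, 'f mat) idem_sys rel"
  note equiv = equiv_idem_sys_iso_rel[of d, where ?'f = 'f and ?'a = "'f mat"]
  have R: "R \<in> carrier_mat (d + 1) (d + 1)" "invertible_mat R"
    "idempotent_system d (Phi d R)" "symmetric_idempotent_system d (Phi d R)" if "R \<in> ?AO" for R
  proof -
    show R: "R \<in> carrier_mat (d + 1) (d + 1)" "invertible_mat R"
      using that by (auto simp: solid_invertible_def)
    then show "idempotent_system d (Phi d R)"
      using idempotent_system_Phi_iff that by blast
    then show "symmetric_idempotent_system d (Phi d R)"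
      using symmetric_Phi_iff[OF R] that by blast
  qed
  have classes: "AO_solid_classes d = (\<lambda>R. diag_equiv d `` {R}) ` ?AO"
    by (auto simp: AO_solid_classes_def quotient_def)
  have sym_class: "?r `` {\<Phi>} \<in> symmetric_idem_sys_classes d"
    if "symmetric_idempotent_system d \<Phi>" for \<Phi>
    unfolding symmetric_idem_sys_classes_def by (rule quotientI) (use that in simp)
  have "inj_on (Phi_class d) (AO_solid_classes d :: 'f mat set set)"
  proof (rule inj_onI)
    fix \<rho> \<sigma> :: "'f mat set"
    assume "\<rho> \<in> AO_solid_classes d" "\<sigma> \<in> AO_solid_classes d" and eq: "Phi_class d \<rho> = Phi_class d \<sigma>"
    then obtain P Q where PQ: "P \<in> ?AO" "Q \<in> ?AO"
      and \<rho>: "\<rho> = diag_equiv d `` {P}" and \<sigma>: "\<sigma> = diag_equiv d `` {Q}"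
      unfolding classes by blast
    have "?r `` {Phi d P} = ?r `` {Phi d Q}"
      using eq PQ by (simp add: \<rho> \<sigma> Phi_class_eq)
    then have "(Phi d P, Phi d Q) \<in> ?r"
      using eq_equiv_class[OF _ equiv] R(3)[OF PQ(2)] by blast
    then have "(P, Q) \<in> diag_equiv d"
      using idem_sys_isomorphic_Phi_iff[OF R(1,2)[OF PQ(1)] R(1,2)[OF PQ(2)]]
      by (simp add: idem_sys_iso_rel_def)
    then show "\<rho> = \<sigma>"
      unfolding \<rho> \<sigma> by (rule equiv_class_eq[OF equiv_diag_equiv])
  qed
  moreover have "Phi_class d ` AO_solid_classes d = (symmetric_idem_sys_classes d :: ('f, 'f mat) idem_sys set set)"
  proof (intro equalityI subsetI)
    fix C assume "C \<in> Phi_class d ` (AO_solid_classes d :: 'f mat set set)"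
    then obtain P where P: "P \<in> ?AO" "C = Phi_class d (diag_equiv d `` {P})"
      unfolding classes by blast
    then show "C \<in> symmetric_idem_sys_classes d"
      using sym_class[OF R(4)[OF P(1)]] by (simp add: Phi_class_eq)
  next
    fix C :: "('f, 'f mat) idem_sys set" assume "C \<in> symmetric_idem_sys_classes d"
    then obtain \<Psi> where \<Psi>: "symmetric_idempotent_system d \<Psi>" "C = ?r `` {\<Psi>}"
      unfolding symmetric_idem_sys_classes_def by (blast elim: quotientE)
    \<comment> \<open>Surjectivity: a matrix representing any member of the class is a preimage up
      to diagonal equivalence.\<close>
    obtain P where P: "almost_orthogonal d P" "solid_invertible d P" and iso: "idem_sys_isomorphic d \<Psi> (Phi d P)"
      by (rule symmetric_idempotent_system_representative[OF \<Psi>(1)])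
    then have "(\<Psi>, Phi d P) \<in> ?r"
      using R(3)[of P] symmetric_idempotent_systemD[OF \<Psi>(1)] by (simp add: idem_sys_iso_rel_def)
    then have "C = Phi_class d (diag_equiv d `` {P})"
      unfolding \<Psi>(2) Phi_class_eq[OF P(2)] by (rule equiv_class_eq[OF equiv])
    then show "C \<in> Phi_class d ` AO_solid_classes d"
      unfolding classes using P by blast
  qed
  moreover have "\<exists>!C. C \<in> (symmetric_idem_sys_classes d :: ('f, 'f mat) idem_sys set set) \<and>
      (\<forall>\<Phi>\<in>C. idem_sys_isomorphic d \<Psi> \<Phi>)"
    if \<Psi>: "symmetric_idempotent_system d \<Psi>" for \<Psi> :: "('f, 'a) idem_sys"
  proof -
    obtain P where P: "almost_orthogonal d P" "solid_invertible d P" and iso: "idem_sys_isomorphic d \<Psi> (Phi d P)"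
      by (rule symmetric_idempotent_system_representative[OF \<Psi>])
    show ?thesis
    proof (rule ex1I)
      show "?r `` {Phi d P} \<in> symmetric_idem_sys_classes d \<and>
          (\<forall>\<Phi>\<in>?r `` {Phi d P}. idem_sys_isomorphic d \<Psi> \<Phi>)"
        using sym_class R(4)[of P] P idem_sys_isomorphic_trans[OF iso] by (auto simp: idem_sys_iso_rel_def)
    next
      fix C :: "('f, 'f mat) idem_sys set"
      assume C: "C \<in> symmetric_idem_sys_classes d \<and> (\<forall>\<Phi>\<in>C. idem_sys_isomorphic d \<Psi> \<Phi>)"
      then obtain \<Phi> where \<Phi>: "symmetric_idempotent_system d \<Phi>" "C = ?r `` {\<Phi>}"
        unfolding symmetric_idem_sys_classes_def by (blast elim: quotientE)
      have sys: "idempotent_system d \<Phi>"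
        by (rule symmetric_idempotent_systemD[OF \<Phi>(1)])
      then have "\<Phi> \<in> C"
        unfolding \<Phi>(2) using equiv_class_self[OF equiv] by blast
      then have "idem_sys_isomorphic d \<Psi> \<Phi>"
        using C by blast
      \<comment> \<open>Both systems are isomorphic to \<open>\<Psi>\<close>; the comparison passes
        through its carrier type \<open>'a\<close>.\<close>
      then have "idem_sys_isomorphic d \<Phi> (Phi d P)"
        using idem_sys_isomorphic_sym[OF symmetric_idempotent_systemD[OF \<Psi>]]
          idem_sys_isomorphic_trans iso by blast
      then have "(\<Phi>, Phi d P) \<in> ?r"
        using sys R(3)[of P] P by (simp add: idem_sys_iso_rel_def)
      then show "C = ?r `` {Phi d P}"
        unfolding \<Phi>(2) by (rule equiv_class_eq[OF equiv])
    qed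
  qed
  ultimately show ?thesis
    by (simp add: bij_betw_def)
qed

end
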